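(* Let $\beta>0$ and let $\alpha_1,\alpha_2,\dots\in\Delta$ be distributed according to $\prod_{n=1}^{\infty}\frac{n\beta}{\pi}(1-|\alpha_n|^2)^{n\beta-1}d\lambda(\alpha_n)$. Let $p,q$ be multi-indices. If $d=\deg(p)=\deg(q)$, then $E(x^p(x^q)^* )$ is the sum over multi-indices $\mathbf m=(\mathbf m(0),\mathbf m(1),\dots)$ (indexing starting at $0$) $$\sum_{\mathbf m} C(p,q,\mathbf m)\prod_N \frac{\mathbf m(N)!}{(N\beta+1)\cdots(N\beta+\mathbf m(N))},$$ where $C(p,q,\mathbf m)$ is the number of tuples of finite integer sequences $(i_{n,r},j_{n,r},k_{m,s},l_{m,s})$ satisfying the conditions: (1) $n,m\ge 1$, $1\le r\le p(n)$ and $1\le s\le q(m)$; (2) $$i_{n,r}(1)>j_{n,r}(1)>i_{n,r}(2)>\cdots>j_{n,r}(\mathrm{length}(j_{n,r}))\ge 0,$$ $$k_{m,s}(1)>l_{m,s}(1)>k_{m,s}(2)>\cdots>l_{m,s}(\mathrm{length}(l_{m,s}))\ge 0,$$ $$\sum_u (i_{n,r}(u)-j_{n,r}(u))=n,\qquad \sum_v (k_{m,s}(v)-l_{m,s}(v))=m;$$ (3) $$\mathbf m=\sum_{n,r}\delta_{i_{n,r}}+\sum_{m,s}\delta_{l_{m,s}} = \sum_{n,r}\delta_{j_{n,r}}+\sum_{m,s}\delta_{k_{m,s}}.$$ If $\deg(p)\ne \deg(q)$, then $E(x^p(x^q)^* )=0$.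
   Context: $\Delta=\{z\in\mathbb C:|z|<1\}$, $\lambda$ is Lebesgue measure on $\mathbb C$, $(\cdot)^*$ is complex conjugation, and by convention $\alpha_0=1$. A multi-index is a sequence $p=(p(1),p(2),\dots)$ of non-negative integers with only finitely many nonzero entries, $\deg(p)=\sum_j j\,p(j)$, and $x^p=\prod_{n\ge1}x_n^{p(n)}$; $\mathbf m$ is of the same kind but indexed from $0$. For $n\ge1$, $x_n$ is the sum of all terms $$\alpha_{i(1)}\alpha_{j(1)}^*\cdots\alpha_{i(L)}\alpha_{j(L)}^*,$$ over all $L\ge1$ and integers $i(1)>j(1)>i(2)>\cdots>i(L)>j(L)\ge 0$ with $\sum_{u=1}^L(i(u)-j(u))=n$. Here the infinite sum is understood as the limit, as $N\to\infty$ (almost surely and in $L^2$), of the finite sums over terms with $i(1)\le N$. (For finitely many $\alpha$'s these are the coefficients of the reversed orthogonal polynomial $1+\sum_n x_nz^n$ determined by $r_0=1$, $r_n(z)=r_{n-1}(z)+\alpha_nz^n\overline{r_{n-1}(1/\bar z)}$.) In (2), for each $(n,r)$ the sequences $i_{n,r}$, $j_{n,r}$ have the same length, and for each $(m,s)$ the sequences $k_{m,s}$, $l_{m,s}$ have the same length. For a function $i$ on a finite domain with values in the non-negative integers, $\delta_i$ is the density of its image: $\delta_i(N)$ is the number of points of the domain mapped to $N$, $N\ge0$. *)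

theory Defs
  imports "HOL-Probability.Probability"
begin

section \<open>Multi-indices\<close>

text \<open>Finitely supported sequences indexed from 0 (as used for the summation index) and
  from 1; in the second case the unused entry at 0 is normalised to 0.\<close>

definition multi_index0 :: "(nat \<Rightarrow> nat) \<Rightarrow> bool" where
  "multi_index0 m \<longleftrightarrow> finite {N. m N \<noteq> 0}"

definition multi_index :: "(nat \<Rightarrow> nat) \<Rightarrow> bool" where
  "multi_index p \<longleftrightarrow> p 0 = 0 \<and> finite {n. p n \<noteq> 0}"

definition mdeg :: "(nat \<Rightarrow> nat) \<Rightarrow> nat" where
  "mdeg p = (\<Sum>j | p j \<noteq> 0. j * p j)"

definition monomial :: "(nat \<Rightarrow> nat) \<Rightarrow> (nat \<Rightarrow> complex) \<Rightarrow> complex" where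
  "monomial p x = (\<Prod>n | p n \<noteq> 0. x n ^ p n)"

section \<open>The law of the coefficients and the random variables \<open>x\<^sub>n\<close>\<close>

definition alpha_law :: "real \<Rightarrow> nat \<Rightarrow> complex measure" where
  "alpha_law \<beta> n = density lborel (\<lambda>z. ennreal
     (real n * \<beta> / pi * (1 - (cmod z)\<^sup>2) powr (real n * \<beta> - 1) * indicator (ball 0 1) z))"

text \<open>Pairs of sequences \<open>i(1) > j(1) > i(2) > \<dots> > i(L) > j(L) \<ge> 0\<close>, \<open>L \<ge> 1\<close>, with
  \<open>\<Sum>\<^sub>u (i(u) - j(u)) = n\<close>. Lists are numbered from 0; the natural-number subtraction never
  truncates because \<open>i(u) > j(u)\<close>.\<close>

definition interlaced :: "nat \<Rightarrow> (nat list \<times> nat list) set" where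
  "interlaced n = {(i, j). length i = length j \<and> 1 \<le> length i \<and>
     (\<forall>u < length i. i ! u > j ! u) \<and>
     (\<forall>u. Suc u < length i \<longrightarrow> j ! u > i ! Suc u) \<and>
     (\<Sum>u < length i. i ! u - j ! u) = n}"

definition xterm :: "(nat \<Rightarrow> complex) \<Rightarrow> nat list \<times> nat list \<Rightarrow> complex" where
  "xterm a = (\<lambda>(i, j). \<Prod>u < length i. a (i ! u) * cnj (a (j ! u)))"

text \<open>The partial sum over the (finitely many) terms with largest index \<open>i(1) \<le> N\<close>.\<close>

definition xpart :: "(nat \<Rightarrow> complex) \<Rightarrow> nat \<Rightarrow> nat \<Rightarrow> complex" where
  "xpart a N n = (\<Sum>t \<in> {(i, j) \<in> interlaced n. i ! 0 \<le> N}. xterm a t)"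

definition xcoeff :: "(nat \<Rightarrow> complex) \<Rightarrow> nat \<Rightarrow> complex" where
  "xcoeff a n = lim (\<lambda>N. xpart a N n)"

section \<open>The combinatorial coefficient\<close>

definition slots :: "(nat \<Rightarrow> nat) \<Rightarrow> (nat \<times> nat) set" where
  "slots p = {(n, r). 1 \<le> n \<and> 1 \<le> r \<and> r \<le> p n}"

text \<open>The families \<open>i\<^sub>n\<^sub>,\<^sub>r\<close>, \<open>j\<^sub>n\<^sub>,\<^sub>r\<close>, \<open>k\<^sub>m\<^sub>,\<^sub>s\<close>, \<open>l\<^sub>m\<^sub>,\<^sub>s\<close> are total functions on pairs; extensionality
  fixes their irrelevant values, so that each tuple of sequences is counted exactly once.
  The density \<open>\<delta>\<^sub>i(N)\<close> of a sequence \<open>i\<close> is \<open>count_list i N\<close>.\<close>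

definition tuples :: "(nat \<Rightarrow> nat) \<Rightarrow> (nat \<Rightarrow> nat) \<Rightarrow> (nat \<Rightarrow> nat) \<Rightarrow>
    ((nat \<times> nat \<Rightarrow> nat list) \<times> (nat \<times> nat \<Rightarrow> nat list) \<times>
     (nat \<times> nat \<Rightarrow> nat list) \<times> (nat \<times> nat \<Rightarrow> nat list)) set" where
  "tuples p q m = {(i, j, k, l).
     i \<in> extensional (slots p) \<and> j \<in> extensional (slots p) \<and>
     k \<in> extensional (slots q) \<and> l \<in> extensional (slots q) \<and>
     (\<forall>(n, r) \<in> slots p. (i (n, r), j (n, r)) \<in> interlaced n) \<and>
     (\<forall>(n, s) \<in> slots q. (k (n, s), l (n, s)) \<in> interlaced n) \<and>
     (\<forall>N. m N = (\<Sum>t\<in>slots p. count_list (i t) N) + (\<Sum>t\<in>slots q. count_list (l t) N)) \<and>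
     (\<forall>N. m N = (\<Sum>t\<in>slots p. count_list (j t) N) + (\<Sum>t\<in>slots q. count_list (k t) N))}"

definition C_count :: "(nat \<Rightarrow> nat) \<Rightarrow> (nat \<Rightarrow> nat) \<Rightarrow> (nat \<Rightarrow> nat) \<Rightarrow> nat" where
  "C_count p q m = card (tuples p q m)"

text \<open>Factors with \<open>m N = 0\<close> equal 1, so the product may be restricted to the support.\<close>

definition weight :: "real \<Rightarrow> (nat \<Rightarrow> nat) \<Rightarrow> real" where
  "weight \<beta> m = (\<Prod>N | m N \<noteq> 0. fact (m N) / (\<Prod>h = 1..m N. real N * \<beta> + real h))"

end

(* Write y_N for the partial sum of x_n over terms with i(1) <= N. Then y_N - y_(N-1) = alpha_N A_N, where
   A_N depends only on alpha_1, ..., alpha_(N-1) and is of size N^(-1/2), like alpha_N itself. Expanding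
   |y_(N-1) + alpha_N A_N|^(2r) and using the rotation invariance of alpha_N gives, by induction on n,
   E |y_N - y_M|^(2r) = O(M^(-r)) for N >= M. With r = 2 these bounds are summable in M, which gives
   almost sure convergence; for general r they give uniform L^2 bounds on the monomials in the partial
   sums, so their expectations converge. These expectations are explicit: by rotation invariance only
   the tuples with equal exponents of alpha_v and its conjugate contribute, each its weight, and these
   nonnegative terms increase to the series over all tuples. Comparing the sums of the indices shows
   that such tuples exist only when the degrees agree. *)
theory Submission
  imports Defs
begin

section \<open>Rotation invariance and moments of the disc laws\<close>

text \<open>The size of A_N comes from its shape: with d = i(1) - j(1) it is a sum of at most n
  products of the conjugate of alpha_(N-d) and a partial sum of x_(n-d) (1 if d = n) that uses only
  indices below N-d. The two factors are independent, and a shift of the index by at most n costs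
  only a constant. So alpha_N A_N has second moment O(N^(-2)); summing over indices beyond M gives
  1/M, hence the rate M^(-r) for the 2r-th moment. The rate 1/M for r = 1 is not summable over M. It
  is summable along a geometric subsequence, which produces a candidate limit, and r = 2 then brings
  the whole sequence to that candidate. The constant alpha_0 = 1 has no rotation invariance, so
  independence says nothing about its two exponents. They agree nevertheless once all others do,
  because i and j have equal length in each slot. The coefficient C is a cardinality, so each set of
  tuples must be finite; this is read off from the convergence of the series, whose terms have
  positive weight.\<close>

lemma lborel_complex_eq_distr_vec2:
  "(lborel :: complex measure) = distr (lborel :: (real^2) measure) borel (\<lambda>v. Complex (v $ 1) (v $ 2))"
proof (rule lborel_eqI)
  have cont: "continuous_on UNIV (\<lambda>v::real^2. Complex (v $ 1) (v $ 2))"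
    unfolding Complex_eq by (intro continuous_intros)
  have meas: "(\<lambda>v::real^2. Complex (v $ 1) (v $ 2)) \<in> lborel \<rightarrow>\<^sub>M borel"
    using borel_measurable_continuous_onI[OF cont] by simp
  fix l u :: complex
  assume le: "\<And>b. b \<in> Basis \<Longrightarrow> l \<bullet> b \<le> u \<bullet> b"
  have vim: "(\<lambda>v::real^2. Complex (v $ 1) (v $ 2)) -` box l u
     = box (vector [Re l, Im l]) (vector [Re u, Im u])"
    by (auto simp: box_def Basis_complex_def Basis_vec_def inner_axis forall_2)
  have b1: "Re l \<le> Re u" "Im l \<le> Im u" using le[of 1] le[of \<i>] by (auto simp: Basis_complex_def)
  have B: "(Basis :: (real^2) set) = {axis 1 1, axis 2 1}"
    by (auto simp: Basis_vec_def UNIV_2)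
  have ne: "axis (1::2) (1::real) \<noteq> axis 2 1" by (auto simp: axis_eq_axis)
  show "emeasure (distr lborel borel (\<lambda>v::real^2. Complex (v $ 1) (v $ 2))) (box l u) = (\<Prod>b\<in>Basis. (u - l) \<bullet> b)"
    using b1 ne
    by (simp add: emeasure_distr[OF meas] vim emeasure_lborel_box_eq B inner_axis Basis_complex_def)
qed simp

text \<open>Boxes determine Lebesgue measure, and the preimage of a box under \<open>f\<close> is
  its image under the inverse \<open>g\<close>, which is again orthogonal and preserves the measure
  of images.\<close>

lemma lborel_distr_orthogonal:
  fixes f :: "real^'n::{finite,wellorder} \<Rightarrow> real^'n::_"
  assumes f: "orthogonal_transformation f"
  shows "distr lborel borel f = lborel"
proof (rule lborel_eqI[symmetric])
  have lin: "linear f" using f by (rule orthogonal_transformation_linear)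
  have meas: "f \<in> borel_measurable lborel"
    using borel_measurable_continuous_onI[OF linear_continuous_on] lin
    by (simp add: linear_conv_bounded_linear)
  fix l u :: "real^'n::{finite,wellorder}"
  assume le: "\<And>b. b \<in> Basis \<Longrightarrow> l \<bullet> b \<le> u \<bullet> b"
  obtain g where g: "orthogonal_transformation g" "\<And>x. g (f x) = x" "\<And>y. f (g y) = y"
    using orthogonal_transformation_inv[OF f] orthogonal_transformation_bij[OF f]
    by (metis bij_inv_eq_iff)
  have vim: "f -` box l u = g ` box l u"
    using g(2,3) by (auto simp: image_iff) metis
  have lm: "g ` box l u \<in> lmeasurable" by (rule measurable_orthogonal_image[OF g(1)]) simp
  have bo: "f -` box l u \<in> sets borel" using measurable_sets[OF meas, of "box l u"] by simp
  have "emeasure (distr lborel borel f) (box l u) = emeasure lborel (f -` box l u)"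
    using meas by (simp add: emeasure_distr)
  also have "\<dots> = emeasure lebesgue (g ` box l u)"
    using bo by (simp add: vim)
  also have "\<dots> = measure lebesgue (g ` box l u)"
    using lm by (simp add: emeasure_eq_measure2 fmeasurableD2)
  also have "\<dots> = measure lebesgue (box l u)"
    by (subst measure_orthogonal_image[OF g(1)]) auto
  also have "\<dots> = (\<Prod>b\<in>Basis. (u - l) \<bullet> b)"
    using le by (simp add: measure_completion measure_lborel_box_eq)
  finally show "emeasure (distr lborel borel f) (box l u) = (\<Prod>b\<in>Basis. (u - l) \<bullet> b)" .
qed simp

text \<open>In the coordinates \<open>\<phi>\<close>, multiplication by \<open>c\<close> is the
  linear isometry \<open>f\<close> of \<open>real^2\<close>, and \<open>\<phi>\<close> transports
  Lebesgue measure.\<close>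

lemma lborel_complex_distr_rotation:
  assumes c: "cmod c = 1"
  shows "distr lborel borel ((*) c) = lborel"
proof -
  define \<phi> where "\<phi> = (\<lambda>v::real^2. Complex (v $ 1) (v $ 2))"
  define f where "f = (\<lambda>v::real^2. (vector [Re c * v$1 - Im c * v$2, Re c * v$2 + Im c * v$1] :: real^2))"
  have \<phi>[measurable]: "\<phi> \<in> borel_measurable borel"
    unfolding \<phi>_def Complex_eq by (intro borel_measurable_continuous_onI continuous_intros)
  have lin: "linear f" unfolding f_def
    by (intro linearI) (auto simp: vec_eq_iff forall_2 algebra_simps)
  have n2: "norm v ^ 2 = (v$1)\<^sup>2 + (v$2)\<^sup>2" for v :: "real^2"
    by (simp add: norm_vec_def L2_set_def sum_2)
  have c2: "(Re c)\<^sup>2 + (Im c)\<^sup>2 = 1" using c by (simp add: cmod_def)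
  have "norm (f v) ^ 2 = norm v ^ 2" for v
  proof -
    have "norm (f v) ^ 2 = ((Re c)\<^sup>2 + (Im c)\<^sup>2) * ((v$1)\<^sup>2 + (v$2)\<^sup>2)"
      unfolding n2 by (simp add: f_def power2_eq_square algebra_simps)
    thus ?thesis by (simp add: c2 n2)
  qed
  hence "norm (f v) = norm v" for v by (metis norm_ge_zero power2_eq_imp_eq)
  hence orth: "orthogonal_transformation f" using lin by (simp add: orthogonal_transformation)
  have fm[measurable]: "f \<in> borel_measurable borel"
    using borel_measurable_continuous_onI[OF linear_continuous_on] lin
    by (simp add: linear_conv_bounded_linear)
  have "\<phi> (f v) = c * \<phi> v" for v by (simp add: \<phi>_def f_def complex_eq_iff)
  hence comm: "(*) c \<circ> \<phi> = \<phi> \<circ> f" by (auto simp: fun_eq_iff)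
  have L: "lborel = distr lborel borel \<phi>" unfolding \<phi>_def by (rule lborel_complex_eq_distr_vec2)
  have "distr lborel borel ((*) c) = distr (distr lborel borel \<phi>) borel ((*) c)"
    using L by simp
  also have "\<dots> = distr lborel borel (\<phi> \<circ> f)" by (subst distr_distr) (auto simp: comm)
  also have "\<dots> = distr (distr lborel borel f) borel \<phi>" by (subst distr_distr) auto
  also have "\<dots> = lborel" using L by (simp add: lborel_distr_orthogonal[OF orth])
  finally show ?thesis .
qed

text \<open>The disc of radius sqrt(a) has area pi a, so the squared modulus is uniform with total
  mass pi. This does the work of polar coordinates.\<close>

lemma lborel_complex_distr_cmod_square:
  "distr (restrict_space lborel (ball (0::complex) 1)) borel (\<lambda>z. (cmod z)\<^sup>2)
   = density lborel (\<lambda>t. ennreal (pi * indicator {0..<1} t))" (is "?L = ?R")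
proof (rule measure_eqI_generator_eq[where E = "range (\<lambda>a::real. {..a})" and \<Omega> = UNIV and A = "\<lambda>i::nat. {..real i}"])
  have em: "emeasure ?L {..a} = ennreal (pi * (max 0 (min a 1)))" for a
  proof -
    have eq: "(\<lambda>z. (cmod z)\<^sup>2) -` {..a} \<inter> ball (0::complex) 1 = 
       (if a < 0 then {} else if a < 1 then cball 0 (sqrt a) else ball 0 1)"
    proof -
      consider "a < 0" | "0 \<le> a" "a < 1" | "1 \<le> a" by linarith
      thus ?thesis
      proof cases
        case 1
        hence "\<not> (cmod z)\<^sup>2 \<le> a" for z using zero_le_power2[of "cmod z"] by linarith
        with 1 show ?thesis by auto
      next
        case 2
        have "(cmod z)\<^sup>2 \<le> a \<longleftrightarrow> cmod z \<le> sqrt a" for z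
          by (metis norm_ge_zero real_sqrt_le_iff real_sqrt_abs abs_of_nonneg)
        moreover have "sqrt a < 1" using 2 by simp
        hence "cmod z < 1" if "cmod z \<le> sqrt a" for z using that by linarith
        ultimately show ?thesis using 2 by auto
      next
        case 3
        have "(cmod z)\<^sup>2 \<le> a" if "cmod z < 1" for z
          using power_le_one[of "cmod z" 2] that 3 by simp
        with 3 show ?thesis by auto
      qed
    qed
    have ball: "cmod z < 1" if "a < 1" "cmod z \<le> sqrt a" for z
      using le_less_trans[OF that(2), of 1] that(1) by simp
    have meas: "(\<lambda>z. (cmod z)\<^sup>2) \<in> restrict_space lborel (ball (0::complex) 1) \<rightarrow>\<^sub>M borel"
      by (intro measurable_restrict_space1) auto
    have "emeasure ?L {..a} = emeasure (restrict_space lborel (ball (0::complex) 1))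
       ((\<lambda>z. (cmod z)\<^sup>2) -` {..a} \<inter> ball 0 1)"
      by (subst emeasure_distr[OF meas]) (auto simp: space_restrict_space)
    also have "\<dots> = emeasure lborel (if a < 0 then {} else if a < 1 then cball 0 (sqrt a) else ball (0::complex) 1)"
      by (subst emeasure_restrict_space) (auto simp: eq ball)
    also have "\<dots> = ennreal (pi * (max 0 (min a 1)))"
      by (auto simp: emeasure_cball emeasure_ball unit_ball_vol_2)
    finally show ?thesis .
  qed
  show "emeasure ?L X = emeasure ?R X" if "X \<in> range (\<lambda>a::real. {..a})" for X
  proof -
    from that obtain a where X: "X = {..a}" by auto
    have "emeasure ?R X = (\<integral>\<^sup>+t. ennreal pi * indicator ({0..<1} \<inter> {..a}) t \<partial>lborel)"
      unfolding X by (subst emeasure_density) (auto intro!: nn_integral_cong simp: indicator_def)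
    also have "\<dots> = ennreal pi * emeasure lborel ({0..<1} \<inter> {..a})"
      by (subst nn_integral_cmult_indicator) auto
    also have "{0..<1} \<inter> {..a} = (if a < 0 then {} else if a < 1 then {0..a} else {0..<1})" by auto
    also have "ennreal pi * emeasure lborel \<dots> = ennreal (pi * (max 0 (min a 1)))"
      by (auto simp: ennreal_mult ennreal_neg max_def min_def)
    finally show ?thesis unfolding X em by simp
  qed
  show "emeasure ?L {..real i} \<noteq> \<infinity>" for i :: nat unfolding em by simp
  show "(\<Union>i. {..real i}) = UNIV" using real_arch_simple by auto
  show "Int_stable (range (\<lambda>a::real. {..a}))" by (auto simp: Int_stable_def intro!: image_eqI[of _ _ "min _ _"])
qed (auto simp: borel_eq_atMost intro!: )


text \<open>This is the Beta integral B(k+1, b), with the Gamma quotient reduced to a finite product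
  by k+1 uses of the functional equation.\<close>

lemma has_integral_Beta_power:
  fixes b :: real
  assumes "b > 0"
  shows "((\<lambda>t. t ^ k * (1 - t) powr (b - 1)) has_integral fact k / (\<Prod>h=0..k. b + real h)) {0<..<1}"
proof -
  have G: "Gamma (b + real (Suc k)) = (\<Prod>h=0..k. b + real h) * Gamma b" for k
  proof (induction k)
    case 0
    show ?case using Gamma_plus1[of b] assms by (simp add: add_ac nonpos_Ints_def)
  next
    case (Suc k)
    have "b + real (Suc k) \<notin> \<int>\<^sub>\<le>\<^sub>0" using assms by (auto elim!: nonpos_Ints_cases)
    hence "Gamma (b + real (Suc k) + 1) = (b + real (Suc k)) * Gamma (b + real (Suc k))"
      by (rule Gamma_plus1)
    thus ?case using Suc.IH by (simp add: algebra_simps)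
  qed
  have pos: "Gamma b > 0" using assms by (rule Gamma_real_pos)
  have "Beta (real k + 1) b = fact k / (\<Prod>h=0..k. b + real h)"
    using G[of k] pos Gamma_fact[of k, where 'a = real]
    by (simp add: Beta_def add_ac)
  \<comment> \<open>The open interval matters at t = 0 when k = 0: there \<open>t powr 0\<close> is
    0 while \<open>t ^ 0\<close> is 1.\<close>
  moreover have "((\<lambda>t. t powr (real k + 1 - 1) * (1 - t) powr (b - 1)) has_integral Beta (real k + 1) b) {0<..<1}"
    using has_integral_Beta_real[of "real k + 1" b] assms by (simp add: has_integral_Icc_iff_Ioo)
  ultimately show ?thesis
    by (subst has_integral_cong[where g = "\<lambda>t. t powr (real k + 1 - 1) * (1 - t) powr (b - 1)"])
      (auto simp: powr_realpow)
qed

lemma borel_measurable_disc_density[measurable]: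
  "(\<lambda>z::complex. c * (1 - (cmod z)\<^sup>2) powr e * indicator (ball 0 1) z) \<in> borel_measurable borel"
  by (intro borel_measurable_times powr_real_measurable borel_measurable_indicator) auto

text \<open>The value of E |alpha_n|^(2k), and at the same time the factor of \<open>weight\<close>
  at n. For n = 0 it is 1, in accordance with alpha_0 = 1.\<close>

definition disc_moment :: "real \<Rightarrow> nat \<Rightarrow> nat \<Rightarrow> real" where
  "disc_moment \<beta> n k = fact k / (\<Prod>h=1..k. real n * \<beta> + real h)"

lemma sets_alpha_law[measurable_cong, simp]: "sets (alpha_law \<beta> n) = sets borel"
  by (simp add: alpha_law_def)

lemma space_alpha_law[simp]: "space (alpha_law \<beta> n) = UNIV"
  by (simp add: alpha_law_def)

text \<open>Substituting t = |z|^2 turns the law into the density b (1-t)^(b-1) on the unit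
  interval, b = n beta, so the moment is a Beta integral.\<close>

lemma nn_integral_alpha_law_norm_power:
  assumes "\<beta> > 0" "n \<ge> 1"
  shows "(\<integral>\<^sup>+z. ennreal (cmod z ^ (2 * k)) \<partial>alpha_law \<beta> n) = ennreal (disc_moment \<beta> n k)"
proof -
  define b where "b = real n * \<beta>"
  have b: "b > 0" using assms by (simp add: b_def)
  define g where "g = (\<lambda>t::real. b / pi * (t ^ k * (1 - t) powr (b - 1)))"
  have [measurable]: "g \<in> borel_measurable borel" unfolding g_def by measurable
  have "(\<integral>\<^sup>+z. ennreal (cmod z ^ (2 * k)) \<partial>alpha_law \<beta> n)
    = (\<integral>\<^sup>+z. ennreal (b / pi * (1 - (cmod z)\<^sup>2) powr (b - 1) * indicator (ball 0 1) z) * ennreal (cmod z ^ (2 * k)) \<partial>lborel)"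
    unfolding alpha_law_def b_def by (rule nn_integral_density) measurable
  also have "\<dots> = (\<integral>\<^sup>+z. ennreal (g ((cmod z)\<^sup>2)) * indicator (ball 0 1) z \<partial>lborel)"
    by (intro nn_integral_cong)
      (use b in \<open>auto simp: g_def indicator_def power_mult[symmetric] mult_ac simp flip: ennreal_mult''\<close>)
  also have "\<dots> = (\<integral>\<^sup>+z. ennreal (g ((cmod z)\<^sup>2)) \<partial>restrict_space lborel (ball 0 1))"
    by (subst nn_integral_restrict_space) auto
  also have "\<dots> = (\<integral>\<^sup>+t. ennreal (g t) \<partial>distr (restrict_space lborel (ball (0::complex) 1)) borel (\<lambda>z. (cmod z)\<^sup>2))"
    by (subst nn_integral_distr) (auto intro!: measurable_restrict_space1)
  also have "\<dots> = (\<integral>\<^sup>+t. ennreal (pi * indicator {0..<1} t) * ennreal (g t) \<partial>lborel)"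
    unfolding lborel_complex_distr_cmod_square by (subst nn_integral_density) auto
  also have "\<dots> = (\<integral>\<^sup>+t. ennreal (indicator {0<..<1} t * (b * (t ^ k * (1 - t) powr (b - 1)))) \<partial>lborel)"
  proof (intro nn_integral_cong_AE)
    have "AE t::real in lborel. t \<noteq> 0" by (rule AE_lborel_singleton)
    thus "AE t in lborel. ennreal (pi * indicator {0..<1} t) * ennreal (g t)
        = ennreal (indicator {0<..<1} t * (b * (t ^ k * (1 - t) powr (b - 1))))"
      by eventually_elim (auto simp: g_def indicator_def simp flip: ennreal_mult')
  qed
  also have "\<dots> = ennreal (b * (fact k / (\<Prod>h=0..k. b + real h)))"
    using nn_integral_has_integral_lebesgue[OF _ has_integral_mult_right[OF has_integral_Beta_power[OF b, of k], of b]] b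
    by simp
  \<comment> \<open>The factor h = 0 of the product is \<open>b\<close> itself and cancels the
    normalisation.\<close>
  also have "b * (fact k / (\<Prod>h=0..k. b + real h)) = disc_moment \<beta> n k"
    using assms by (simp add: disc_moment_def b_def prod.atLeast_Suc_atMost)
  finally show ?thesis .
qed

lemma prob_space_alpha_law:
  assumes "\<beta> > 0" "n \<ge> 1"
  shows "prob_space (alpha_law \<beta> n)"
  using nn_integral_alpha_law_norm_power[OF assms, of 0]
  by (intro prob_spaceI) (simp add: disc_moment_def)

lemma AE_alpha_law_le_1: "AE z in alpha_law \<beta> n. cmod z \<le> 1"
  unfolding alpha_law_def by (subst AE_density) (auto simp: indicator_def)

lemma alpha_law_rotation:
  assumes c: "cmod c = 1"
  shows "distr (alpha_law \<beta> n) borel ((*) c) = alpha_law \<beta> n"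
proof -
  let ?f = "\<lambda>z. ennreal (real n * \<beta> / pi * (1 - (cmod z)\<^sup>2) powr (real n * \<beta> - 1) * indicator (ball 0 1) z)"
  have "alpha_law \<beta> n = density (distr lborel borel ((*) c)) ?f"
    by (simp add: alpha_law_def lborel_complex_distr_rotation[OF c])
  also have "\<dots> = distr (density lborel (\<lambda>z. ?f (c * z))) borel ((*) c)"
    by (rule density_distr) measurable
  also have "(\<lambda>z. ?f (c * z)) = ?f" using c by (auto simp: norm_mult indicator_def)
  finally show ?thesis by (simp add: alpha_law_def)
qed

lemma integral_alpha_law_monomial:
  assumes "\<beta> > 0" "n \<ge> 1"
  shows "(\<integral>z. z ^ a * cnj z ^ b \<partial>alpha_law \<beta> n) = (if a = b then of_real (disc_moment \<beta> n a) else 0)"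
proof (cases "a = b")
  case True
  have pos: "disc_moment \<beta> n a \<ge> 0" using assms by (auto simp: disc_moment_def intro!: divide_nonneg_nonneg prod_nonneg)
  have "(\<integral>z. z ^ a * cnj z ^ a \<partial>alpha_law \<beta> n) = (\<integral>z. complex_of_real (cmod z ^ (2 * a)) \<partial>alpha_law \<beta> n)"
    by (intro Bochner_Integration.integral_cong)
      (simp_all add: power_mult complex_norm_square[symmetric] flip: power_mult_distrib)
  also have "\<dots> = of_real (\<integral>z. cmod z ^ (2 * a) \<partial>alpha_law \<beta> n)" by (rule integral_complex_of_real)
  also have "(\<integral>z. cmod z ^ (2 * a) \<partial>alpha_law \<beta> n) = disc_moment \<beta> n a"
    using nn_integral_alpha_law_norm_power[OF assms, of a] pos
    by (subst integral_eq_nn_integral) auto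
  finally show ?thesis using True by simp
next
  case False
  \<comment> \<open>Rotation by \<open>c\<close> changes the sign of the integrand.\<close>
  define c where "c = cis (pi / (real a - real b))"
  have "c ^ a * cnj c ^ b = cis (real a * (pi / (real a - real b)) - real b * (pi / (real a - real b)))"
    by (simp only: c_def cis_cnj Complex.DeMoivre cis_mult cis_inverse minus_mult_right diff_conv_add_uminus)
  also have "real a * (pi / (real a - real b)) - real b * (pi / (real a - real b)) = pi"
    using False by (simp flip: left_diff_distrib add: diff_divide_distrib[symmetric])
  finally have m1: "c ^ a * cnj c ^ b = -1" by simp
  have "(\<integral>z. z ^ a * cnj z ^ b \<partial>alpha_law \<beta> n) = (\<integral>z. z ^ a * cnj z ^ b \<partial>distr (alpha_law \<beta> n) borel ((*) c))"
    by (subst alpha_law_rotation) (auto simp: c_def)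
  also have "\<dots> = (\<integral>z. (c * z) ^ a * cnj (c * z) ^ b \<partial>alpha_law \<beta> n)"
    by (subst integral_distr) (auto intro!: borel_measurable_continuous_onI continuous_intros)
  also have "\<dots> = (\<integral>z. (c ^ a * cnj c ^ b) * (z ^ a * cnj z ^ b) \<partial>alpha_law \<beta> n)"
    by (simp add: power_mult_distrib mult_ac)
  also have "\<dots> = - (\<integral>z. z ^ a * cnj z ^ b \<partial>alpha_law \<beta> n)" unfolding m1 by simp
  finally show ?thesis using False by (simp add: eq_neg_iff_add_eq_0 flip: mult_2)
qed

section \<open>Independence\<close>

lemma disc_moment_0_right [simp]: "disc_moment \<beta> n 0 = 1"
  by (simp add: disc_moment_def)

lemma disc_moment_0_left [simp]: "disc_moment \<beta> 0 k = 1"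
  by (simp add: disc_moment_def fact_prod)

text \<open>The single equation \<open>joint_law\<close> carries both the marginals and the
  independence; index 0 stays outside it because alpha_0 is constant.\<close>

locale disc_sequence = prob_space M for M :: "'a measure" +
  fixes \<alpha> :: "nat \<Rightarrow> 'a \<Rightarrow> complex" and \<beta> :: real
  assumes beta_pos: "\<beta> > 0"
    and alpha_0: "\<And>\<omega>. \<omega> \<in> space M \<Longrightarrow> \<alpha> 0 \<omega> = 1"
    and alpha_measurable': "\<And>n. n \<ge> 1 \<Longrightarrow> \<alpha> n \<in> borel_measurable M"
    and joint_law: "distr M (Pi\<^sub>M {1..} (\<lambda>_. borel)) (\<lambda>\<omega>. \<lambda>n\<in>{1..}. \<alpha> n \<omega>) = Pi\<^sub>M {1..} (alpha_law \<beta>)"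
begin

lemma alpha_measurable [measurable]: "\<alpha> n \<in> borel_measurable M"
proof (cases "n = 0")
  case True
  have "\<alpha> 0 \<in> borel_measurable M \<longleftrightarrow> (\<lambda>_. 1::complex) \<in> borel_measurable M"
    by (rule measurable_cong) (rule alpha_0)
  with True show ?thesis by simp
qed (use alpha_measurable' in auto)

lemma distr_alpha:
  assumes "n \<ge> 1"
  shows "distr M borel (\<alpha> n) = alpha_law \<beta> n"
proof -
  have "distr M borel (\<alpha> n) = distr (distr M (Pi\<^sub>M {1..} (\<lambda>_. borel)) (\<lambda>\<omega>. \<lambda>n\<in>{1..}. \<alpha> n \<omega>)) borel (\<lambda>f. f n)"
    using assms by (subst distr_distr) (auto simp: comp_def intro!: measurable_component_singleton measurable_restrict)
  also have "\<dots> = distr (Pi\<^sub>M {1..} (alpha_law \<beta>)) (alpha_law \<beta> n) (\<lambda>f. f n)"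
    unfolding joint_law by (intro distr_cong) auto
  also have "\<dots> = alpha_law \<beta> n"
    using assms beta_pos by (intro distr_PiM_component prob_space_alpha_law) auto
  finally show ?thesis .
qed

lemma indep_alpha: "indep_vars (\<lambda>_. borel) \<alpha> {1..}"
proof (subst indep_vars_iff_distr_eq_PiM')
  show "distr M (Pi\<^sub>M {1..} (\<lambda>_. borel)) (\<lambda>\<omega>. \<lambda>n\<in>{1..}. \<alpha> n \<omega>) = Pi\<^sub>M {1..} (\<lambda>n. distr M borel (\<alpha> n))"
    unfolding joint_law by (intro PiM_cong) (auto simp: distr_alpha)
qed auto

lemma AE_alpha_le_1: "AE \<omega> in M. \<forall>n. cmod (\<alpha> n \<omega>) \<le> 1"
proof (subst AE_all_countable, intro allI)
  fix n
  show "AE \<omega> in M. cmod (\<alpha> n \<omega>) \<le> 1"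
  proof (cases "n = 0")
    case True
    thus ?thesis using alpha_0 by (auto intro!: AE_I2)
  next
    case False
    hence "AE z in distr M borel (\<alpha> n). cmod z \<le> 1"
      using AE_alpha_law_le_1[of \<beta> n] by (subst distr_alpha) auto
    thus ?thesis by (subst (asm) AE_distr_iff) auto
  qed
qed

lemma expectation_alpha_monomial:
  assumes "n \<ge> 1"
  shows "expectation (\<lambda>\<omega>. \<alpha> n \<omega> ^ a * cnj (\<alpha> n \<omega>) ^ b) = (if a = b then of_real (disc_moment \<beta> n a) else 0)"
proof -
  have "expectation (\<lambda>\<omega>. \<alpha> n \<omega> ^ a * cnj (\<alpha> n \<omega>) ^ b) = (\<integral>z. z ^ a * cnj z ^ b \<partial>distr M borel (\<alpha> n))"
    by (subst integral_distr) (auto intro!: borel_measurable_continuous_onI continuous_intros)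
  thus ?thesis using integral_alpha_law_monomial[OF beta_pos assms] assms by (simp add: distr_alpha)
qed

text \<open>Dependence on the coefficients before index N is expressed by an explicit measurable
  factorisation, so that independence from alpha_N follows by composition. The essential bound makes
  every product integrable; it is stated almost surely because that is how |alpha_i| <= 1 is
  available.\<close>

definition past :: "nat \<Rightarrow> ('a \<Rightarrow> complex) \<Rightarrow> bool" where
  "past N F \<longleftrightarrow> (\<exists>G\<in>borel_measurable (PiM {1..<N} (\<lambda>_. borel)).
     \<forall>\<omega>\<in>space M. F \<omega> = G (\<lambda>i\<in>{1..<N}. \<alpha> i \<omega>)) \<and> (\<exists>K. AE \<omega> in M. cmod (F \<omega>) \<le> K)"

lemma past_const: "past N (\<lambda>_. c)"
  unfolding past_def by (intro conjI bexI[of _ "\<lambda>_. c"] exI[of _ "cmod c"]) auto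

lemma past_add: assumes "past N F" "past N G" shows "past N (\<lambda>\<omega>. F \<omega> + G \<omega>)"
proof -
  obtain f g K L where *: "f \<in> borel_measurable (PiM {1..<N} (\<lambda>_. borel))" "g \<in> borel_measurable (PiM {1..<N} (\<lambda>_. borel))"
    "\<forall>\<omega>\<in>space M. F \<omega> = f (\<lambda>i\<in>{1..<N}. \<alpha> i \<omega>)" "\<forall>\<omega>\<in>space M. G \<omega> = g (\<lambda>i\<in>{1..<N}. \<alpha> i \<omega>)"
    "AE \<omega> in M. cmod (F \<omega>) \<le> K" "AE \<omega> in M. cmod (G \<omega>) \<le> L"
    using assms unfolding past_def by blast
  have "AE \<omega> in M. cmod (F \<omega> + G \<omega>) \<le> K + L"
    using *(5,6) by eventually_elim (rule order_trans[OF norm_triangle_ineq add_mono])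
  thus ?thesis unfolding past_def using *
    by (intro conjI bexI[of _ "\<lambda>x. f x + g x"] exI[of _ "K + L"]) auto
qed

lemma past_mult: assumes "past N F" "past N G" shows "past N (\<lambda>\<omega>. F \<omega> * G \<omega>)"
proof -
  obtain f g K L where *: "f \<in> borel_measurable (PiM {1..<N} (\<lambda>_. borel))" "g \<in> borel_measurable (PiM {1..<N} (\<lambda>_. borel))"
    "\<forall>\<omega>\<in>space M. F \<omega> = f (\<lambda>i\<in>{1..<N}. \<alpha> i \<omega>)" "\<forall>\<omega>\<in>space M. G \<omega> = g (\<lambda>i\<in>{1..<N}. \<alpha> i \<omega>)"
    "AE \<omega> in M. cmod (F \<omega>) \<le> K" "AE \<omega> in M. cmod (G \<omega>) \<le> L"
    using assms unfolding past_def by blast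
  have "AE \<omega> in M. cmod (F \<omega> * G \<omega>) \<le> K * L"
    using *(5,6) by eventually_elim (auto simp: norm_mult intro!: mult_mono order_trans[OF norm_ge_zero])
  thus ?thesis unfolding past_def using *
    by (intro conjI bexI[of _ "\<lambda>x. f x * g x"] exI[of _ "K * L"]) auto
qed

lemma past_cnj: assumes "past N F" shows "past N (\<lambda>\<omega>. cnj (F \<omega>))"
proof -
  obtain f K where *: "f \<in> borel_measurable (PiM {1..<N} (\<lambda>_. borel))"
    "\<forall>\<omega>\<in>space M. F \<omega> = f (\<lambda>i\<in>{1..<N}. \<alpha> i \<omega>)" "AE \<omega> in M. cmod (F \<omega>) \<le> K"
    using assms unfolding past_def by blast
  have "cnj \<in> borel_measurable borel" by (intro borel_measurable_continuous_onI continuous_intros)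
  from measurable_compose[OF *(1) this] show ?thesis unfolding past_def using *(2,3)
    by (intro conjI bexI[of _ "\<lambda>x. cnj (f x)"] exI[of _ K]) auto
qed

lemma past_alpha: assumes "i < N" shows "past N (\<alpha> i)"
  unfolding past_def
proof
  show "\<exists>K. AE \<omega> in M. cmod (\<alpha> i \<omega>) \<le> K" using AE_alpha_le_1 by (intro exI[of _ 1]) auto
  show "\<exists>G\<in>borel_measurable (PiM {1..<N} (\<lambda>_. borel)). \<forall>\<omega>\<in>space M. \<alpha> i \<omega> = G (\<lambda>i\<in>{1..<N}. \<alpha> i \<omega>)"
  proof (cases "i = 0")
    case True
    thus ?thesis by (intro bexI[of _ "\<lambda>_. 1"]) (auto simp: alpha_0)
  next
    case False
    with assms show ?thesis by (intro bexI[of _ "\<lambda>f. f i"]) (auto intro!: measurable_component_singleton)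
  qed
qed

lemma past_mono: assumes "past N F" "N \<le> N'" shows "past N' F"
proof -
  obtain f K where *: "f \<in> borel_measurable (PiM {1..<N} (\<lambda>_. borel))"
    "\<forall>\<omega>\<in>space M. F \<omega> = f (\<lambda>i\<in>{1..<N}. \<alpha> i \<omega>)" "AE \<omega> in M. cmod (F \<omega>) \<le> K"
    using assms unfolding past_def by blast
  have sub: "{1..<N'} \<inter> {1..<N} = {1..<N}" using assms(2) by auto
  have "(\<lambda>x. restrict x {1..<N}) \<in> PiM {1..<N'} (\<lambda>_. borel) \<rightarrow>\<^sub>M PiM {1..<N} (\<lambda>_. borel)"
    using assms(2) by (intro measurable_restrict_subset) auto
  from measurable_compose[OF this *(1)] show ?thesis unfolding past_def using *(2,3) sub
    by (intro conjI bexI[of _ "\<lambda>x. f (restrict x {1..<N})"] exI[of _ K]) (auto simp: restrict_restrict)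
qed

lemma past_sum: "(\<And>t. t \<in> S \<Longrightarrow> past N (F t)) \<Longrightarrow> past N (\<lambda>\<omega>. \<Sum>t\<in>S. F t \<omega>)"
  by (induction S rule: infinite_finite_induct) (auto intro: past_const past_add)

lemma past_prod: "(\<And>t. t \<in> S \<Longrightarrow> past N (F t)) \<Longrightarrow> past N (\<lambda>\<omega>. \<Prod>t\<in>S. F t \<omega>)"
  by (induction S rule: infinite_finite_induct) (auto intro: past_const past_mult)

lemma past_power: "past N F \<Longrightarrow> past N (\<lambda>\<omega>. F \<omega> ^ k)"
  by (induction k) (auto intro: past_const past_mult)

lemma past_diff: assumes "past N F" "past N G" shows "past N (\<lambda>\<omega>. F \<omega> - G \<omega>)"
  using past_add[OF assms(1) past_mult[OF past_const[of N "-1"] assms(2)]] by simp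

lemmas past_intros = past_const past_add past_mult past_cnj past_alpha past_sum past_prod past_power past_diff

lemma past_measurable: assumes "past N F" shows "F \<in> borel_measurable M"
proof -
  obtain f where f: "f \<in> borel_measurable (PiM {1..<N} (\<lambda>_. borel))"
    "\<forall>\<omega>\<in>space M. F \<omega> = f (\<lambda>i\<in>{1..<N}. \<alpha> i \<omega>)"
    using assms unfolding past_def by blast
  have "(\<lambda>\<omega>. f (\<lambda>i\<in>{1..<N}. \<alpha> i \<omega>)) \<in> borel_measurable M"
    by (rule measurable_compose[OF _ f(1)]) (intro measurable_restrict, simp)
  thus ?thesis using f(2) by (subst measurable_cong) auto
qed

lemma past_integrable: assumes "past N F" shows "integrable M F"
proof -
  obtain K where "AE \<omega> in M. cmod (F \<omega>) \<le> K" using assms unfolding past_def by blast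
  thus ?thesis using past_measurable[OF assms] by (intro integrable_const_bound)
qed

lemma past_norm_power_integrable:
  assumes "past N F" shows "integrable M (\<lambda>\<omega>. cmod (F \<omega>) ^ k)"
  using integrable_norm[OF past_integrable[OF past_power[OF assms]], of k] by (simp add: norm_power)

lemma expectation_alpha_past:
  assumes "N \<ge> 1" "past N F"
  shows "expectation (\<lambda>\<omega>. \<alpha> N \<omega> ^ a * cnj (\<alpha> N \<omega>) ^ b * F \<omega>)
    = (if a = b then of_real (disc_moment \<beta> N a) * expectation F else 0)"
proof -
  obtain f where f: "f \<in> borel_measurable (PiM {1..<N} (\<lambda>_. borel))"
    "\<forall>\<omega>\<in>space M. F \<omega> = f (\<lambda>i\<in>{1..<N}. \<alpha> i \<omega>)"
    using assms unfolding past_def by blast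
  let ?Y = "\<lambda>x::nat \<Rightarrow> complex. x N ^ a * cnj (x N) ^ b"
  have "(\<lambda>z. z ^ a * cnj z ^ b) \<in> borel_measurable borel"
    by (intro borel_measurable_continuous_onI continuous_intros)
  hence Y: "?Y \<in> borel_measurable (PiM {N} (\<lambda>_. borel))"
    by (rule measurable_compose[rotated]) (auto intro!: measurable_component_singleton)
  have "indep_var (PiM {N} (\<lambda>_. borel)) (\<lambda>\<omega>. \<lambda>i\<in>{N}. \<alpha> i \<omega>) (PiM {1..<N} (\<lambda>_. borel)) (\<lambda>\<omega>. \<lambda>i\<in>{1..<N}. \<alpha> i \<omega>)"
    using assms(1) by (intro indep_var_restrict[OF indep_alpha]) auto
  from indep_var_compose[OF this Y f(1)]
  have ind: "indep_var borel (\<lambda>\<omega>. \<alpha> N \<omega> ^ a * cnj (\<alpha> N \<omega>) ^ b) borel (\<lambda>\<omega>. f (\<lambda>i\<in>{1..<N}. \<alpha> i \<omega>))"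
    by (simp add: comp_def)
  have i1: "integrable M (\<lambda>\<omega>. \<alpha> N \<omega> ^ a * cnj (\<alpha> N \<omega>) ^ b)"
    by (rule past_integrable[of "Suc N"]) (intro past_intros lessI)
  have i2: "integrable M (\<lambda>\<omega>. f (\<lambda>i\<in>{1..<N}. \<alpha> i \<omega>))"
    using past_integrable[OF assms(2)] f(2) by (subst Bochner_Integration.integrable_cong[where g = F]) auto
  have "expectation (\<lambda>\<omega>. \<alpha> N \<omega> ^ a * cnj (\<alpha> N \<omega>) ^ b * F \<omega>)
      = expectation (\<lambda>\<omega>. \<alpha> N \<omega> ^ a * cnj (\<alpha> N \<omega>) ^ b * f (\<lambda>i\<in>{1..<N}. \<alpha> i \<omega>))"
    using f(2) by (intro Bochner_Integration.integral_cong) auto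
  also have "\<dots> = expectation (\<lambda>\<omega>. \<alpha> N \<omega> ^ a * cnj (\<alpha> N \<omega>) ^ b) * expectation (\<lambda>\<omega>. f (\<lambda>i\<in>{1..<N}. \<alpha> i \<omega>))"
    by (rule indep_var_lebesgue_integral[OF ind i1 i2])
  also have "expectation (\<lambda>\<omega>. f (\<lambda>i\<in>{1..<N}. \<alpha> i \<omega>)) = expectation F"
    using f(2) by (intro Bochner_Integration.integral_cong) auto
  finally show ?thesis by (simp add: expectation_alpha_monomial[OF assms(1)])
qed

lemma expectation_norm_power_alpha_past:
  assumes "past N F"
  shows "expectation (\<lambda>\<omega>. cmod (\<alpha> N \<omega> * F \<omega>) ^ (2 * r)) = disc_moment \<beta> N r * expectation (\<lambda>\<omega>. cmod (F \<omega>) ^ (2 * r))"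
proof (cases "N = 0")
  \<comment> \<open>Both alpha_0 and \<open>disc_moment \<beta> 0 r\<close> equal 1, so j(1) = 0
    fits the general formula later on.\<close>
  case True
  thus ?thesis by (auto intro!: Bochner_Integration.integral_cong simp: alpha_0)
next
  case False
  have nz: "z ^ r * cnj z ^ r = complex_of_real (cmod z ^ (2 * r))" for z
    by (simp_all add: power_mult complex_norm_square[symmetric] flip: power_mult_distrib)
  have "complex_of_real (expectation (\<lambda>\<omega>. cmod (\<alpha> N \<omega> * F \<omega>) ^ (2 * r)))
    = expectation (\<lambda>\<omega>. complex_of_real (cmod (\<alpha> N \<omega> * F \<omega>) ^ (2 * r)))"
    by (rule integral_complex_of_real[symmetric])
  also have "\<dots> = expectation (\<lambda>\<omega>. \<alpha> N \<omega> ^ r * cnj (\<alpha> N \<omega>) ^ r * (F \<omega> ^ r * cnj (F \<omega>) ^ r))"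
    unfolding nz by (simp add: norm_mult power_mult_distrib)
  also have "\<dots> = of_real (disc_moment \<beta> N r) * expectation (\<lambda>\<omega>. F \<omega> ^ r * cnj (F \<omega>) ^ r)"
    using False assms by (subst expectation_alpha_past) (auto intro!: past_intros)
  also have "\<dots> = complex_of_real (disc_moment \<beta> N r * expectation (\<lambda>\<omega>. cmod (F \<omega>) ^ (2 * r)))"
    unfolding nz by (simp only: integral_complex_of_real of_real_mult)
  finally show ?thesis by (simp only: of_real_eq_iff)
qed

text \<open>Rotation invariance of \<open>\<alpha> N\<close> kills the off-diagonal terms of the expansion of
  \<open>(Z + \<alpha> A)\<^sup>r\<close> times its conjugate.\<close>

lemma expectation_norm_power_step:
  assumes "N \<ge> 1" "past N Z" "past N A"
  shows "expectation (\<lambda>\<omega>. cmod (Z \<omega> + \<alpha> N \<omega> * A \<omega>) ^ (2 * r))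
    = (\<Sum>k\<le>r. (real (r choose k))\<^sup>2 * disc_moment \<beta> N k *
        expectation (\<lambda>\<omega>. cmod (A \<omega>) ^ (2 * k) * cmod (Z \<omega>) ^ (2 * (r - k))))"
proof -
  have nz: "z ^ r * cnj z ^ r = complex_of_real (cmod z ^ (2 * r))" for z r
    by (simp_all add: power_mult complex_norm_square[symmetric] flip: power_mult_distrib)
  \<comment> \<open>\<open>H k l\<close> gathers all of the (k,l) term of the double binomial
    expansion except the powers of alpha_N and its conjugate.\<close>
  define H where "H = (\<lambda>k l \<omega>. of_nat (r choose k) * of_nat (r choose l) *
     (A \<omega> ^ k * Z \<omega> ^ (r - k) * (cnj (A \<omega>) ^ l * cnj (Z \<omega>) ^ (r - l))))"
  have H: "past N (H k l)" for k l
    unfolding H_def using assms by (intro past_intros)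
  have int: "integrable M (\<lambda>\<omega>. \<alpha> N \<omega> ^ k * cnj (\<alpha> N \<omega>) ^ l * H k l \<omega>)" for k l
    by (rule past_integrable[of "Suc N"]) (intro past_intros past_mono[OF H] lessI, simp)
  have diag: "expectation (H k k) = of_real ((real (r choose k))\<^sup>2 * expectation (\<lambda>\<omega>. cmod (A \<omega>) ^ (2 * k) * cmod (Z \<omega>) ^ (2 * (r - k))))" for k
  proof -
    have "H k k \<omega> = of_real ((real (r choose k))\<^sup>2 * (cmod (A \<omega>) ^ (2 * k) * cmod (Z \<omega>) ^ (2 * (r - k))))" for \<omega>
    proof -
      have "H k k \<omega> = of_nat (r choose k) * of_nat (r choose k) * ((A \<omega> ^ k * cnj (A \<omega>) ^ k) * (Z \<omega> ^ (r - k) * cnj (Z \<omega>) ^ (r - k)))"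
        by (simp add: H_def mult_ac)
      thus ?thesis unfolding nz by (simp add: power2_eq_square)
    qed
    hence "H k k = (\<lambda>\<omega>. of_real ((real (r choose k))\<^sup>2 * (cmod (A \<omega>) ^ (2 * k) * cmod (Z \<omega>) ^ (2 * (r - k)))))" by auto
    thus ?thesis by (simp only: integral_complex_of_real integral_mult_right_zero)
  qed
  have "complex_of_real (expectation (\<lambda>\<omega>. cmod (Z \<omega> + \<alpha> N \<omega> * A \<omega>) ^ (2 * r)))
    = expectation (\<lambda>\<omega>. complex_of_real (cmod (Z \<omega> + \<alpha> N \<omega> * A \<omega>) ^ (2 * r)))"
    by (rule integral_complex_of_real[symmetric])
  also have "\<dots> = expectation (\<lambda>\<omega>. \<Sum>k\<le>r. \<Sum>l\<le>r. \<alpha> N \<omega> ^ k * cnj (\<alpha> N \<omega>) ^ l * H k l \<omega>)"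
  proof (intro Bochner_Integration.integral_cong refl)
    fix \<omega>
    have "complex_of_real (cmod (Z \<omega> + \<alpha> N \<omega> * A \<omega>) ^ (2 * r)) = (\<alpha> N \<omega> * A \<omega> + Z \<omega>) ^ r * (cnj (\<alpha> N \<omega>) * cnj (A \<omega>) + cnj (Z \<omega>)) ^ r"
      using nz[of "\<alpha> N \<omega> * A \<omega> + Z \<omega>" r] by (simp add: add.commute)
    also have "\<dots> = (\<Sum>k\<le>r. \<Sum>l\<le>r. \<alpha> N \<omega> ^ k * cnj (\<alpha> N \<omega>) ^ l * H k l \<omega>)"
      unfolding binomial_ring sum_product H_def by (simp add: power_mult_distrib mult_ac)
    finally show "complex_of_real (cmod (Z \<omega> + \<alpha> N \<omega> * A \<omega>) ^ (2 * r)) = \<dots>" .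
  qed
  also have "\<dots> = (\<Sum>k\<le>r. \<Sum>l\<le>r. expectation (\<lambda>\<omega>. \<alpha> N \<omega> ^ k * cnj (\<alpha> N \<omega>) ^ l * H k l \<omega>))"
    by (subst Bochner_Integration.integral_sum)
      (auto intro!: Bochner_Integration.integrable_sum int sum.cong Bochner_Integration.integral_sum)
  also have "\<dots> = (\<Sum>k\<le>r. \<Sum>l\<le>r. if k = l then of_real (disc_moment \<beta> N k) * expectation (H k l) else 0)"
    by (simp add: expectation_alpha_past[OF assms(1) H])
  also have "\<dots> = (\<Sum>k\<le>r. of_real (disc_moment \<beta> N k) * expectation (H k k))"
    by (auto intro!: sum.cong simp: sum.delta')
  also have "\<dots> = of_real (\<Sum>k\<le>r. disc_moment \<beta> N k * ((real (r choose k))\<^sup>2 *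
        expectation (\<lambda>\<omega>. cmod (A \<omega>) ^ (2 * k) * cmod (Z \<omega>) ^ (2 * (r - k)))))"
    by (simp add: diag)
  finally have "complex_of_real (expectation (\<lambda>\<omega>. cmod (Z \<omega> + \<alpha> N \<omega> * A \<omega>) ^ (2 * r)))
    = of_real (\<Sum>k\<le>r. disc_moment \<beta> N k * ((real (r choose k))\<^sup>2 *
        expectation (\<lambda>\<omega>. cmod (A \<omega>) ^ (2 * k) * cmod (Z \<omega>) ^ (2 * (r - k)))))" .
  thus ?thesis by (simp only: of_real_eq_iff mult_ac)
qed

end

section \<open>Recursion for the partial sums\<close>

lemma interlaced_imp_pos: "(i, j) \<in> interlaced n \<Longrightarrow> n > 0"
proof -
  assume *: "(i, j) \<in> interlaced n"
  hence "0 < length i" by (auto simp: interlaced_def)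
  with * have "0 < i ! 0 - j ! 0" by (auto simp: interlaced_def)
  moreover have "i ! 0 - j ! 0 \<le> (\<Sum>u < length i. i ! u - j ! u)"
    using * by (intro member_le_sum[where f = "\<lambda>u. i ! u - j ! u"]) (auto simp: interlaced_def)
  ultimately show "n > 0" using * by (auto simp: interlaced_def)
qed

lemma interlaced_Nil [simp]: "([], j) \<notin> interlaced n" "(i, []) \<notin> interlaced n"
  by (auto simp: interlaced_def)

text \<open>The first pair is removed. A nonempty rest has positive total, which gives
  \<open>a - b < n\<close> and keeps the truncated subtraction exact.\<close>

lemma interlaced_Cons:
  "(a # i, b # j) \<in> interlaced n \<longleftrightarrow> b < a \<and>
     (i = [] \<and> j = [] \<and> n = a - b \<or> a - b < n \<and> (i, j) \<in> interlaced (n - (a - b)) \<and> i ! 0 < b)"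
proof -
  have 1: "(\<forall>u < length (a # i). (a # i) ! u > (b # j) ! u) \<longleftrightarrow> b < a \<and> (\<forall>u < length i. i ! u > j ! u)"
    by (auto simp: nth_Cons split: nat.splits)
  have 2: "(\<forall>u. Suc u < length (a # i) \<longrightarrow> (b # j) ! u > (a # i) ! Suc u) \<longleftrightarrow>
     (i \<noteq> [] \<longrightarrow> b > i ! 0) \<and> (\<forall>u. Suc u < length i \<longrightarrow> j ! u > i ! Suc u)"
    by (auto simp: nth_Cons split: nat.splits)
  have 3: "(\<Sum>u < length (a # i). (a # i) ! u - (b # j) ! u) = (a - b) + (\<Sum>u < length i. i ! u - j ! u)"
    by (simp add: sum.lessThan_Suc_shift del: sum.lessThan_Suc)
  have M: "(a # i, b # j) \<in> interlaced n \<longleftrightarrow> length i = length j \<and> b < a \<and> (\<forall>u < length i. i ! u > j ! u) \<and>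
     (i \<noteq> [] \<longrightarrow> b > i ! 0) \<and> (\<forall>u. Suc u < length i \<longrightarrow> j ! u > i ! Suc u) \<and>
     (a - b) + (\<Sum>u < length i. i ! u - j ! u) = n"
    unfolding interlaced_def mem_Collect_eq case_prod_conv 1 2 3 by auto
  show ?thesis
  proof (cases "i = []")
    case True
    thus ?thesis unfolding M by auto
  next
    case False
    hence N: "(i, j) \<in> interlaced m \<longleftrightarrow> length i = length j \<and> (\<forall>u < length i. i ! u > j ! u) \<and>
     (\<forall>u. Suc u < length i \<longrightarrow> j ! u > i ! Suc u) \<and> (\<Sum>u < length i. i ! u - j ! u) = m" for m
      by (auto simp: interlaced_def Suc_le_eq)
    have "a - b < n" if "(a # i, b # j) \<in> interlaced n"
    proof -
      have "(i, j) \<in> interlaced (n - (a - b))" using that unfolding M N by auto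
      thus ?thesis using interlaced_imp_pos by fastforce
    qed
    thus ?thesis unfolding M N using False by auto
  qed
qed

text \<open>Induction on removing the first pair. The length bound serves finiteness, the bounds by
  \<open>i ! 0\<close> locate the coefficients that a term involves, and the sum identity is the
  source of the degree condition.\<close>

lemma interlaced_bounds:
  assumes "(i, j) \<in> interlaced n"
  shows "length i \<le> n" "length j = length i" "i \<noteq> []" "\<And>x. x \<in> set i \<Longrightarrow> x \<le> i ! 0" "\<And>x. x \<in> set j \<Longrightarrow> x < i ! 0"
    "sum_list i = sum_list j + n"
proof -
  have "length i \<le> n \<and> length j = length i \<and> i \<noteq> [] \<and> (\<forall>x\<in>set i. x \<le> i ! 0) \<and> (\<forall>x\<in>set j. x < i ! 0) \<and> sum_list i = sum_list j + n"
    using assms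
  proof (induction i arbitrary: j n)
    case (Cons a i)
    then obtain b j' where j: "j = b # j'" by (cases j) auto
    from Cons.prems[unfolded j interlaced_Cons] show ?case
    proof (elim conjE disjE)
      assume *: "b < a" "a - b < n" "(i, j') \<in> interlaced (n - (a - b))" "i ! 0 < b"
      from Cons.IH[OF *(3)] *(1,2,4) j show ?case by fastforce
    qed (auto simp: j)
  qed auto
  thus "length i \<le> n" "length j = length i" "i \<noteq> []" "\<And>x. x \<in> set i \<Longrightarrow> x \<le> i ! 0" "\<And>x. x \<in> set j \<Longrightarrow> x < i ! 0"
    "sum_list i = sum_list j + n" by auto
qed

definition interlaced_upto :: "nat \<Rightarrow> nat \<Rightarrow> (nat list \<times> nat list) set" where
  "interlaced_upto N n = {(i, j) \<in> interlaced n. i ! 0 \<le> N}"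

lemma xpart_eq: "xpart a N n = (\<Sum>t \<in> interlaced_upto N n. xterm a t)"
  by (simp add: xpart_def interlaced_upto_def)

lemma finite_interlaced_upto [simp]: "finite (interlaced_upto N n)"
proof -
  have "interlaced_upto N n \<subseteq> {xs. set xs \<subseteq> {..N} \<and> length xs \<le> n} \<times> {xs. set xs \<subseteq> {..N} \<and> length xs \<le> n}"
  proof (rule subrelI)
    fix i j assume "(i, j) \<in> interlaced_upto N n"
    hence "(i, j) \<in> interlaced n" "i ! 0 \<le> N" by (auto simp: interlaced_upto_def)
    with interlaced_bounds[OF this(1)]
    show "(i, j) \<in> {xs. set xs \<subseteq> {..N} \<and> length xs \<le> n} \<times> {xs. set xs \<subseteq> {..N} \<and> length xs \<le> n}"
      by (fastforce intro: order_trans less_imp_le)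
  qed
  thus ?thesis by (rule finite_subset) (intro finite_cartesian_product finite_lists_length_le finite_atMost)
qed

lemma xterm_Cons: "xterm a (A # i, B # j) = a A * cnj (a B) * xterm a (i, j)"
  by (simp add: xterm_def prod.lessThan_Suc_shift del: prod.lessThan_Suc)

lemma interlaced_upto_0 [simp]: "interlaced_upto 0 n = {}"
proof -
  have False if "(i, j) \<in> interlaced n" "i ! 0 = 0" for i j
    using interlaced_bounds[OF that(1)] that(2) by (cases j) auto
  thus ?thesis by (auto simp: interlaced_upto_def)
qed

lemma xpart_0 [simp]: "xpart a 0 n = 0"
  by (simp add: xpart_eq)

text \<open>The new terms have i(1) = N+1; they are sorted by d = i(1) - j(1). The rest must start
  strictly below j(1) = N+1-d, hence at most at N-d. For d = N+1 nothing fits below j(1) = 0; there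
  \<open>N - d\<close> truncates to 0 and \<open>interlaced_upto 0\<close> is empty, as it should
  be.\<close>

lemma interlaced_upto_Suc:
  "interlaced_upto (Suc N) n = interlaced_upto N n \<union>
     (\<Union>d\<in>{1..min n (Suc N)}. (\<lambda>(i, j). (Suc N # i, (Suc N - d) # j)) `
        (if d = n then {([], [])} else interlaced_upto (N - d) (n - d)))" (is "_ = _ \<union> ?R")
proof (intro equalityI subsetI)
  fix t assume "t \<in> interlaced_upto (Suc N) n"
  then obtain i j where t: "t = (i, j)" "(i, j) \<in> interlaced n" "i ! 0 \<le> Suc N"
    by (auto simp: interlaced_upto_def)
  show "t \<in> interlaced_upto N n \<union> ?R"
  proof (cases "i ! 0 = Suc N")
    case False
    thus ?thesis using t by (auto simp: interlaced_upto_def)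
  next
    case True
    obtain i' b j' where ij: "i = Suc N # i'" "j = b # j'" using t(2) True by (cases i; cases j) auto
    define d where "d = Suc N - b"
    have *: "b < Suc N" "i' = [] \<and> j' = [] \<and> n = d \<or> d < n \<and> (i', j') \<in> interlaced (n - d) \<and> i' ! 0 < b"
      using t(2) unfolding ij interlaced_Cons d_def by auto
    have b: "b = Suc N - d" "d \<ge> 1" "d \<le> Suc N" "d \<le> n" using * by (auto simp: d_def)
    have "(i', j') \<in> (if d = n then {([], [])} else interlaced_upto (N - d) (n - d))"
      using * b by (auto simp: interlaced_upto_def)
    thus ?thesis unfolding t(1) ij b(1) using b by (intro UnI2 UN_I[of d]) auto
  qed
next
  fix t assume "t \<in> interlaced_upto N n \<union> ?R"
  thus "t \<in> interlaced_upto (Suc N) n"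
  proof
    assume "t \<in> ?R"
    then obtain d i j where d: "1 \<le> d" "d \<le> n" "d \<le> Suc N" "t = (Suc N # i, (Suc N - d) # j)"
      "(i, j) \<in> (if d = n then {([], [])} else interlaced_upto (N - d) (n - d))" by auto
    have "d \<le> N" if "d \<noteq> n" using d(3,5) that by (cases "d = Suc N") auto
    with d show ?thesis by (auto simp: interlaced_upto_def interlaced_Cons Suc_diff_le split: if_splits)
  qed (auto simp: interlaced_upto_def)
qed

text \<open>The factor of the new coefficient involves only partial sums of x_(n-d) with n-d smaller
  than n, which is what makes induction on n possible. The 1 at d = n plays the part of x_0.\<close>

lemma xpart_Suc:
  "xpart a (Suc N) n = xpart a N n + a (Suc N) * (\<Sum>d=1..min n (Suc N).
     cnj (a (Suc N - d)) * (if d = n then 1 else xpart a (N - d) (n - d)))"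
proof -
  let ?S = "\<lambda>d. if d = n then {([], [])} else interlaced_upto (N - d) (n - d)"
  let ?f = "\<lambda>d (i, j). (Suc N # i, (Suc N - d) # j)"
  have "xpart a (Suc N) n = xpart a N n + (\<Sum>t\<in>(\<Union>d\<in>{1..min n (Suc N)}. ?f d ` ?S d). xterm a t)"
    unfolding xpart_eq interlaced_upto_Suc
    by (intro sum.union_disjoint) (auto, auto simp: interlaced_upto_def)
  also have "(\<Sum>t\<in>(\<Union>d\<in>{1..min n (Suc N)}. ?f d ` ?S d). xterm a t) = (\<Sum>d\<in>{1..min n (Suc N)}. \<Sum>t\<in>?f d ` ?S d. xterm a t)"
    by (intro sum.UNION_disjoint) auto
  also have "\<dots> = (\<Sum>d\<in>{1..min n (Suc N)}. \<Sum>t\<in>?S d. a (Suc N) * cnj (a (Suc N - d)) * xterm a t)"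
  proof (rule sum.cong[OF refl])
    fix d
    have "inj_on (?f d) (?S d)" by (auto simp: inj_on_def)
    thus "(\<Sum>t\<in>?f d ` ?S d. xterm a t) = (\<Sum>t\<in>?S d. a (Suc N) * cnj (a (Suc N - d)) * xterm a t)"
      by (subst sum.reindex) (auto intro!: sum.cong simp: xterm_Cons)
  qed
  also have "\<dots> = a (Suc N) * (\<Sum>d=1..min n (Suc N).
     cnj (a (Suc N - d)) * (if d = n then 1 else xpart a (N - d) (n - d)))"
    unfolding sum_distrib_left by (intro sum.cong refl) (auto simp: xpart_eq sum_distrib_left mult_ac xterm_def)
  finally show ?thesis .
qed

section \<open>Moment bounds\<close>

text \<open>A crude Young inequality: both bases are replaced by the larger one.\<close>

lemma mult_power_le_power_add:
  fixes a b :: real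
  assumes "a \<ge> 0" "b \<ge> 0" "k \<le> r"
  shows "a ^ k * b ^ (r - k) \<le> a ^ r + b ^ r"
proof (cases "a \<le> b")
  case True
  have "a ^ k * b ^ (r - k) \<le> b ^ k * b ^ (r - k)"
    using assms True by (intro mult_right_mono power_mono) auto
  also have "\<dots> = b ^ r" using assms by (simp flip: power_add)
  finally show ?thesis using assms(1) by (simp add: add_increasing)
next
  case False
  have "a ^ k * b ^ (r - k) \<le> a ^ k * a ^ (r - k)"
    using assms False by (intro mult_left_mono power_mono) auto
  also have "\<dots> = a ^ r" using assms by (simp flip: power_add)
  finally show ?thesis using assms(2) by (simp add: add_increasing2)
qed

text \<open>The sum is at most the number of terms times the largest term. Positivity of
  \<open>m\<close> covers the empty set, where the case \<open>m = 0\<close> would read 1 <=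
  0.\<close>

lemma sum_power_le_card_power:
  fixes a :: "'b \<Rightarrow> real"
  assumes "finite S" "\<And>x. x \<in> S \<Longrightarrow> 0 \<le> a x" "m > 0"
  shows "(\<Sum>x\<in>S. a x) ^ m \<le> real (card S) ^ m * (\<Sum>x\<in>S. a x ^ m)"
proof (cases "S = {}")
  case False
  obtain y where y: "y \<in> S" "\<And>x. x \<in> S \<Longrightarrow> a x \<le> a y"
    using Max_in[of "a ` S"] Max_ge[of "a ` S"] assms(1) False by fastforce
  have "(\<Sum>x\<in>S. a x) ^ m \<le> (real (card S) * a y) ^ m"
    using y assms(2) by (intro power_mono sum_bounded_above sum_nonneg) auto
  also have "\<dots> = real (card S) ^ m * a y ^ m" by (simp add: power_mult_distrib)
  also have "\<dots> \<le> real (card S) ^ m * (\<Sum>x\<in>S. a x ^ m)"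
    using y assms by (intro mult_left_mono member_le_sum[of y S "\<lambda>x. a x ^ m"]) auto
  finally show ?thesis .
qed (use assms in \<open>auto simp: power_0_left\<close>)

text \<open>Since h >= 1, each factor n beta + h is at least min(1, beta) (n+1). The shift to n+1
  keeps the bound meaningful at n = 0.\<close>

lemma disc_moment_le:
  assumes "\<beta> > 0"
  shows "disc_moment \<beta> n k \<le> fact k / min 1 \<beta> ^ k / (real n + 1) ^ k"
proof -
  have c: "min 1 \<beta> > 0" using assms by simp
  have "(min 1 \<beta> * (real n + 1)) ^ k = (\<Prod>h=1..k. min 1 \<beta> * (real n + 1))" by simp
  also have "\<dots> \<le> (\<Prod>h=1..k. real n * \<beta> + real h)"
  proof (intro prod_mono conjI)
    fix h assume h: "h \<in> {1..k}"
    have "min 1 \<beta> * (real n + 1) = real n * min 1 \<beta> + min 1 \<beta>" by (simp add: algebra_simps)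
    also have "\<dots> \<le> real n * \<beta> + real h" using h by (intro add_mono mult_left_mono) auto
    finally show "min 1 \<beta> * (real n + 1) \<le> real n * \<beta> + real h" .
  qed (use c in auto)
  finally have "fact k / (\<Prod>h=1..k. real n * \<beta> + real h) \<le> fact k / (min 1 \<beta> * (real n + 1)) ^ k"
    using c by (intro divide_left_mono mult_pos_pos prod_pos zero_less_power) (auto intro: add_nonneg_pos simp: assms less_imp_le)
  thus ?thesis by (simp add: disc_moment_def power_mult_distrib)
qed

text \<open>The squared binomials are those of the expansion of |Z + alpha A|^(2r), the quotients
  those of \<open>disc_moment_le\<close>. The sum starts at k = 1 because the term k = 0 merely
  reproduces the moment of Z.\<close>

definition growth_const :: "real \<Rightarrow> nat \<Rightarrow> real" where
  "growth_const \<beta> r = (\<Sum>k=1..r. (real (r choose k))\<^sup>2 * (fact k / min 1 \<beta> ^ k))"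

lemma growth_const_nonneg: "\<beta> > 0 \<Longrightarrow> growth_const \<beta> r \<ge> 0"
  unfolding growth_const_def by (intro sum_nonneg mult_nonneg_nonneg divide_nonneg_nonneg) auto

section \<open>Moment recursion for the partial sums\<close>

context disc_sequence
begin

lemma past_mult_norm_integrable:
  assumes "past N F" "past N G"
  shows "integrable M (\<lambda>\<omega>. cmod (F \<omega>) ^ k * cmod (G \<omega>) ^ l)"
  using integrable_norm[OF past_integrable[OF past_mult[OF past_power[OF assms(1)] past_power[OF assms(2)]]], of k l]
  by (simp add: norm_mult norm_power)

text \<open>With \<open>L = m + 1\<close> for the starting index \<open>m\<close> of the martingale, \<open>n |A|\<^sup>2\<close> and \<open>L |Z|\<^sup>2\<close> are both of order 1;
  in this scaling the \<open>k\<close>-th term of the expansion carries a factor \<open>(L / n\<^sup>2)\<^sup>k \<le> L / n\<^sup>2\<close>, which is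
  summable over \<open>n \<ge> L\<close> with a sum bounded independently of \<open>L\<close>.\<close>

lemma moment_increment_le:
  assumes n: "n = Suc N" and past: "past n Z" "past n A"
    and L: "0 < L" "L \<le> n" and K: "expectation (\<lambda>\<omega>. cmod (A \<omega>) ^ (2 * r)) \<le> K / real n ^ r"
  defines "s \<equiv> expectation (\<lambda>\<omega>. cmod (Z \<omega>) ^ (2 * r))"
  shows "K + real L ^ r * expectation (\<lambda>\<omega>. cmod (Z \<omega> + \<alpha> n \<omega> * A \<omega>) ^ (2 * r))
    \<le> (K + real L ^ r * s) * (1 + growth_const \<beta> r * real L / (real n)\<^sup>2)"
proof -
  define e where "e = (\<lambda>k. expectation (\<lambda>\<omega>. cmod (A \<omega>) ^ (2 * k) * cmod (Z \<omega>) ^ (2 * (r - k))))"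
  have n0: "real n > 0" using n by simp
  have L0: "real L > 0" using L by simp
  have s0: "s \<ge> 0" unfolding s_def by (intro integral_nonneg_AE AE_I2) auto
  have e0: "e k \<ge> 0" for k unfolding e_def by (intro integral_nonneg_AE AE_I2) auto
  have K0: "K \<ge> 0"
  proof -
    have "0 \<le> expectation (\<lambda>\<omega>. cmod (A \<omega>) ^ (2 * r))" by (intro integral_nonneg_AE AE_I2) auto
    with K have "0 \<le> K / real n ^ r" by linarith
    moreover have "real n ^ r > 0" using n0 by simp
    ultimately show ?thesis by (metis divide_neg_pos not_le)
  qed
  \<comment> \<open>Mixed moments are controlled by the two pure ones, after scaling |A|^2 by n and
    |Z|^2 by L.\<close>
  have ek: "real n ^ k * real L ^ (r - k) * e k \<le> K + real L ^ r * s" if "k \<le> r" for k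
  proof -
    have "real n ^ k * real L ^ (r - k) * e k = expectation (\<lambda>\<omega>. real n ^ k * real L ^ (r - k) * (cmod (A \<omega>) ^ (2 * k) * cmod (Z \<omega>) ^ (2 * (r - k))))"
      unfolding e_def by simp
    also have "\<dots> \<le> expectation (\<lambda>\<omega>. real n ^ r * cmod (A \<omega>) ^ (2 * r) + real L ^ r * cmod (Z \<omega>) ^ (2 * r))"
    proof (intro integral_mono)
      fix \<omega>
      have "(real n * (cmod (A \<omega>))\<^sup>2) ^ k * (real L * (cmod (Z \<omega>))\<^sup>2) ^ (r - k)
         \<le> (real n * (cmod (A \<omega>))\<^sup>2) ^ r + (real L * (cmod (Z \<omega>))\<^sup>2) ^ r"
        by (rule mult_power_le_power_add) (use that in auto)
      thus "real n ^ k * real L ^ (r - k) * (cmod (A \<omega>) ^ (2 * k) * cmod (Z \<omega>) ^ (2 * (r - k)))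
        \<le> real n ^ r * cmod (A \<omega>) ^ (2 * r) + real L ^ r * cmod (Z \<omega>) ^ (2 * r)"
        by (simp add: power_mult_distrib mult_ac flip: power_mult)
    qed (auto intro!: past_mult_norm_integrable[OF past(2,1)] past_norm_power_integrable[OF past(1)] past_norm_power_integrable[OF past(2)])
    also have "\<dots> = real n ^ r * expectation (\<lambda>\<omega>. cmod (A \<omega>) ^ (2 * r)) + real L ^ r * s"
      unfolding s_def using past_norm_power_integrable[OF past(1)] past_norm_power_integrable[OF past(2)]
      by (subst Bochner_Integration.integral_add) auto
    also have "real n ^ r * expectation (\<lambda>\<omega>. cmod (A \<omega>) ^ (2 * r)) \<le> K"
      using K n0 by (simp add: field_simps)
    finally show ?thesis by simp
  qed
  \<comment> \<open>At most 1, so that for k >= 1 the k-th power can be replaced by the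
    first.\<close>
  have LN: "real L / (real n)\<^sup>2 \<le> 1" "0 \<le> real L / (real n)\<^sup>2"
  proof -
    have "real L * 1 \<le> real n * real n" using L by (intro mult_mono) auto
    thus "real L / (real n)\<^sup>2 \<le> 1" using n0 by (simp add: power2_eq_square)
  qed auto
  have incr: "real L ^ r * ((real (r choose k))\<^sup>2 * disc_moment \<beta> n k * e k)
     \<le> (real (r choose k))\<^sup>2 * (fact k / min 1 \<beta> ^ k) * (real L / (real n)\<^sup>2 * (K + real L ^ r * s))"
    if k: "k \<in> {1..r}" for k
  proof -
    have "disc_moment \<beta> n k \<le> fact k / min 1 \<beta> ^ k / (real n + 1) ^ k"
      by (rule disc_moment_le[OF beta_pos])
    also have "\<dots> \<le> fact k / min 1 \<beta> ^ k / real n ^ k"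
      using n0 beta_pos by (intro divide_left_mono power_mono) (auto intro!: mult_pos_pos)
    finally have d: "disc_moment \<beta> n k \<le> fact k / min 1 \<beta> ^ k / real n ^ k" .
    have "real L ^ r * e k / real n ^ k = (real L ^ k / real n ^ (2 * k)) * (real n ^ k * real L ^ (r - k) * e k)"
    proof -
      have "real L ^ r = real L ^ k * real L ^ (r - k)" using k by (simp flip: power_add)
      thus ?thesis using n0 by (simp add: field_simps mult_2_right power_add)
    qed
    also have "real L ^ k / real n ^ (2 * k) = (real L / (real n)\<^sup>2) ^ k"
      by (simp add: power_divide power_mult)
    also have "\<dots> * (real n ^ k * real L ^ (r - k) * e k) \<le> real L / (real n)\<^sup>2 * (K + real L ^ r * s)"
    proof (rule mult_mono)
      show "(real L / (real n)\<^sup>2) ^ k \<le> real L / (real n)\<^sup>2"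
        using power_decreasing[of 1 k "real L / (real n)\<^sup>2"] LN k by auto
    qed (use ek[of k] k LN(2) e0[of k] in auto)
    finally have f: "real L ^ r * e k / real n ^ k \<le> real L / (real n)\<^sup>2 * (K + real L ^ r * s)" .
    have "real L ^ r * ((real (r choose k))\<^sup>2 * disc_moment \<beta> n k * e k)
      = (real (r choose k))\<^sup>2 * (real L ^ r * e k) * disc_moment \<beta> n k" by simp
    also have "\<dots> \<le> (real (r choose k))\<^sup>2 * (real L ^ r * e k) * (fact k / min 1 \<beta> ^ k / real n ^ k)"
      using e0[of k] by (intro mult_left_mono d) auto
    also have "\<dots> = (real (r choose k))\<^sup>2 * (fact k / min 1 \<beta> ^ k) * (real L ^ r * e k / real n ^ k)"
      by simp
    also have "\<dots> \<le> (real (r choose k))\<^sup>2 * (fact k / min 1 \<beta> ^ k) * (real L / (real n)\<^sup>2 * (K + real L ^ r * s))"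
      using beta_pos by (intro mult_left_mono f mult_nonneg_nonneg divide_nonneg_nonneg) auto
    finally show ?thesis .
  qed
  have "real L ^ r * expectation (\<lambda>\<omega>. cmod (Z \<omega> + \<alpha> n \<omega> * A \<omega>) ^ (2 * r))
    = (\<Sum>k\<le>r. real L ^ r * ((real (r choose k))\<^sup>2 * disc_moment \<beta> n k * e k))"
    using n past by (subst expectation_norm_power_step) (auto simp: e_def sum_distrib_left)
  also have "{..r} = insert 0 {1..r}" by auto
  also have "(\<Sum>k\<in>insert 0 {1..r}. real L ^ r * ((real (r choose k))\<^sup>2 * disc_moment \<beta> n k * e k))
    = real L ^ r * s + (\<Sum>k=1..r. real L ^ r * ((real (r choose k))\<^sup>2 * disc_moment \<beta> n k * e k))"
    by (simp add: e_def s_def)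
  also have "\<dots> \<le> real L ^ r * s + (\<Sum>k=1..r. (real (r choose k))\<^sup>2 * (fact k / min 1 \<beta> ^ k) * (real L / (real n)\<^sup>2 * (K + real L ^ r * s)))"
    by (intro add_left_mono sum_mono incr)
  also have "\<dots> = real L ^ r * s + growth_const \<beta> r * (real L / (real n)\<^sup>2 * (K + real L ^ r * s))"
    unfolding growth_const_def sum_distrib_right ..
  finally show ?thesis by (simp add: algebra_simps)
qed

text \<open>A discrete Gronwall argument: each step multiplies \<open>u\<close> by 1 + D L / n^2,
  and the product over n >= L stays below exp(2D) whatever L is. Adding \<open>K\<close> to the
  scaled moment makes the recursion for \<open>u\<close> purely multiplicative.\<close>

lemma moment_martingale_le:
  assumes past: "\<And>N. N \<ge> m \<Longrightarrow> past (Suc N) (Z N)" "\<And>N. N \<ge> m \<Longrightarrow> past (Suc N) (A N)"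
    and Z: "\<And>N \<omega>. N \<ge> m \<Longrightarrow> Z (Suc N) \<omega> = Z N \<omega> + \<alpha> (Suc N) \<omega> * A N \<omega>" "\<And>\<omega>. Z m \<omega> = 0"
    and A: "\<And>N. N \<ge> m \<Longrightarrow> expectation (\<lambda>\<omega>. cmod (A N \<omega>) ^ (2 * r)) \<le> K / real (Suc N) ^ r"
    and r: "r > 0" and N: "N \<ge> m"
  shows "expectation (\<lambda>\<omega>. cmod (Z N \<omega>) ^ (2 * r)) \<le> K * exp (2 * growth_const \<beta> r) / real (Suc m) ^ r"
proof -
  define L where "L = Suc m"
  define u where "u = (\<lambda>N. K + real L ^ r * expectation (\<lambda>\<omega>. cmod (Z N \<omega>) ^ (2 * r)))"
  define D where "D = growth_const \<beta> r"
  have D0: "D \<ge> 0" using growth_const_nonneg[OF beta_pos] by (simp add: D_def)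
  have K0: "K \<ge> 0"
  proof -
    have "0 \<le> expectation (\<lambda>\<omega>. cmod (A m \<omega>) ^ (2 * r))" by (intro integral_nonneg_AE AE_I2) auto
    with A[of m] have "0 \<le> K / real (Suc m) ^ r" by linarith
    moreover have "real (Suc m) ^ r > 0" by simp
    ultimately show ?thesis by (metis divide_neg_pos not_le)
  qed
  have "u N \<le> K * exp (2 * D * real L * (1 / real L - 1 / real (Suc N)))"
    using N
  proof (induction N rule: dec_induct)
    case base
    \<comment> \<open>The process starts at 0, and \<open>0 ^ (2 * r)\<close> vanishes because r >
      0.\<close>
    have "u m = K" using r by (simp add: u_def Z(2))
    thus ?case by (simp add: L_def)
  next
    case (step N)
    have "u (Suc N) \<le> u N * (1 + D * real L / (real (Suc N))\<^sup>2)"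
      using moment_increment_le[OF refl past(1)[of N] past(2)[of N] _ _ A[of N], of L] step.hyps(1)
      by (simp add: u_def Z(1) D_def L_def)
    also have "\<dots> \<le> u N * exp (2 * D * real L * (1 / real (Suc N) - 1 / real (Suc (Suc N))))"
    proof (rule mult_left_mono)
      \<comment> \<open>Comparison with a telescoping difference; its constant 2 is the 2 in the
        final exponential.\<close>
      have "1 / (real (Suc N))\<^sup>2 \<le> 2 * (1 / real (Suc N) - 1 / real (Suc (Suc N)))"
      proof -
        define x where "x = real (Suc N)"
        have x: "x \<ge> 1" by (simp add: x_def)
        have "1 / x\<^sup>2 = 2 / (x * (x + x))" using x by (simp add: power2_eq_square)
        also have "\<dots> \<le> 2 / (x * (x + 1))" using x by (intro divide_left_mono mult_left_mono) auto
        also have "\<dots> = 2 * (1 / x - 1 / (x + 1))" using x by (simp add: field_simps)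
        finally show ?thesis by (simp add: x_def add.commute)
      qed
      hence "D * real L * (1 / (real (Suc N))\<^sup>2) \<le> D * real L * (2 * (1 / real (Suc N) - 1 / real (Suc (Suc N))))"
        using D0 by (intro mult_left_mono) auto
      hence "1 + D * real L / (real (Suc N))\<^sup>2 \<le> 1 + 2 * D * real L * (1 / real (Suc N) - 1 / real (Suc (Suc N)))"
        by (simp add: mult_ac)
      also have "\<dots> \<le> exp (2 * D * real L * (1 / real (Suc N) - 1 / real (Suc (Suc N))))"
        by (rule exp_ge_add_one_self)
      finally show "1 + D * real L / (real (Suc N))\<^sup>2 \<le> exp (2 * D * real L * (1 / real (Suc N) - 1 / real (Suc (Suc N))))" .
      show "0 \<le> u N" unfolding u_def using K0
        by (intro add_nonneg_nonneg mult_nonneg_nonneg integral_nonneg_AE AE_I2) auto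
    qed
    also have "\<dots> \<le> K * exp (2 * D * real L * (1 / real L - 1 / real (Suc N))) * exp (2 * D * real L * (1 / real (Suc N) - 1 / real (Suc (Suc N))))"
      by (intro mult_right_mono step.IH) auto
    also have "\<dots> = K * exp (2 * D * real L * (1 / real L - 1 / real (Suc (Suc N))))"
      by (simp add: mult.assoc flip: exp_add distrib_left)
    finally show ?case .
  qed
  also have "\<dots> \<le> K * exp (2 * D)"
  proof -
    have "2 * D * real L * (1 / real L - 1 / real (Suc N)) \<le> 2 * D * real L * (1 / real L)"
      using D0 by (intro mult_left_mono) auto
    also have "\<dots> = 2 * D" by (simp add: L_def)
    finally show ?thesis using K0 by (intro mult_left_mono) auto
  qed
  finally have "real L ^ r * expectation (\<lambda>\<omega>. cmod (Z N \<omega>) ^ (2 * r)) \<le> K * exp (2 * D)"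
    using K0 by (simp add: u_def)
  thus ?thesis by (simp add: L_def D_def field_simps)
qed

definition x_part :: "nat \<Rightarrow> nat \<Rightarrow> 'a \<Rightarrow> complex" where
  "x_part n N \<omega> = xpart (\<lambda>k. \<alpha> k \<omega>) N n"

text \<open>The factor A of the step from N to N+1. It involves only coefficients of index at most
  N, so it is independent of the new one.\<close>

definition x_incr :: "nat \<Rightarrow> nat \<Rightarrow> 'a \<Rightarrow> complex" where
  "x_incr n N \<omega> = (\<Sum>d=1..min n (Suc N). cnj (\<alpha> (Suc N - d) \<omega>) * (if d = n then 1 else x_part (n - d) (N - d) \<omega>))"

lemma x_part_Suc: "x_part n (Suc N) \<omega> = x_part n N \<omega> + \<alpha> (Suc N) \<omega> * x_incr n N \<omega>"
  unfolding x_part_def x_incr_def by (rule xpart_Suc)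

lemma x_part_0 [simp]: "x_part n 0 \<omega> = 0"
  by (simp add: x_part_def)

lemma past_xterm:
  assumes "(i, j) \<in> interlaced_upto N n"
  shows "past (Suc N) (\<lambda>\<omega>. xterm (\<lambda>k. \<alpha> k \<omega>) (i, j))"
proof -
  have *: "(i, j) \<in> interlaced n" "i ! 0 \<le> N" using assms by (auto simp: interlaced_upto_def)
  have "i ! u < Suc N" "j ! u < Suc N" if "u < length i" for u
    using interlaced_bounds(4)[OF *(1), of "i ! u"] interlaced_bounds(5)[OF *(1), of "j ! u"]
      interlaced_bounds(2)[OF *(1)] *(2) that by auto
  thus ?thesis unfolding xterm_def case_prod_conv by (intro past_intros) auto
qed

lemma past_x_part: "past (Suc N) (x_part n N)"
  unfolding x_part_def[abs_def] xpart_eq by (intro past_sum) (auto intro: past_xterm)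

lemma past_x_incr: "past (Suc N) (x_incr n N)"
  unfolding x_incr_def[abs_def]
proof (intro past_sum past_mult past_cnj)
  fix d assume "d \<in> {1..min n (Suc N)}"
  thus "past (Suc N) (\<alpha> (Suc N - d))" by (intro past_alpha) auto
  show "past (Suc N) (\<lambda>\<omega>. if d = n then 1 else x_part (n - d) (N - d) \<omega>)"
    using past_mono[OF past_x_part[of "N - d" "n - d"], of "Suc N"] by (cases "d = n") (auto intro: past_const)
qed

text \<open>In each summand the coefficient alpha_(N+1-d) is independent of the partial sum next to
  it, so the moments multiply. The constants: \<open>real n ^ (2 * r)\<close> from the power of a
  sum of at most n terms, \<open>real n\<close> from their number, \<open>real n ^ r\<close> from
  the index shift d <= n. The bound C >= 1 also covers the summand d = n, whose second factor is
  1.\<close>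

lemma x_incr_moment_le:
  assumes r: "r > 0" and C: "\<And>m N. m < n \<Longrightarrow> expectation (\<lambda>\<omega>. cmod (x_part m N \<omega>) ^ (2 * r)) \<le> C"
    and C1: "C \<ge> 1"
  shows "expectation (\<lambda>\<omega>. cmod (x_incr n N \<omega>) ^ (2 * r))
    \<le> real n ^ (2 * r) * (real n * (fact r / min 1 \<beta> ^ r * real n ^ r * C)) / real (Suc N) ^ r"
proof -
  define S where "S = {1..min n (Suc N)}"
  define Y where "Y = (\<lambda>d \<omega>. if d = n then 1 else x_part (n - d) (N - d) \<omega>)"
  \<comment> \<open>For d = n the factor is 1, and for d = N+1 different from n it is 0, since
    \<open>N - d\<close> truncates to 0 and the partial sum up to 0 is empty. Otherwise it uses
    indices up to N-d only.\<close>
  have Y_past: "past (Suc N - d) (Y d)" if "d \<in> S" for d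
  proof (cases "d = n \<or> d = Suc N")
    case True
    hence "Y d = (\<lambda>_. 1) \<or> Y d = (\<lambda>_. 0)" by (auto simp: Y_def fun_eq_iff)
    thus ?thesis using past_const by metis
  next
    case False
    with that have "Suc N - d = Suc (N - d)" by (auto simp: S_def)
    with past_x_part[of "N - d" "n - d"] False show ?thesis by (auto simp: Y_def)
  qed
  have Y_le: "expectation (\<lambda>\<omega>. cmod (Y d \<omega>) ^ (2 * r)) \<le> C" if "d \<in> S" for d
    using that C1 C[of "n - d" "N - d"] by (cases "d = n") (auto simp: Y_def S_def prob_space)
  have past_T: "past (Suc N) (\<lambda>\<omega>. \<alpha> (Suc N - d) \<omega> * Y d \<omega>)" if "d \<in> S" for d
    using that by (intro past_mult past_mono[OF Y_past[OF that]] past_alpha) (auto simp: S_def)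
  have "expectation (\<lambda>\<omega>. cmod (x_incr n N \<omega>) ^ (2 * r))
    \<le> expectation (\<lambda>\<omega>. real n ^ (2 * r) * (\<Sum>d\<in>S. cmod (\<alpha> (Suc N - d) \<omega> * Y d \<omega>) ^ (2 * r)))"
  proof (rule integral_mono)
    show "integrable M (\<lambda>\<omega>. cmod (x_incr n N \<omega>) ^ (2 * r))"
      by (rule past_norm_power_integrable[OF past_x_incr])
    show "integrable M (\<lambda>\<omega>. real n ^ (2 * r) * (\<Sum>d\<in>S. cmod (\<alpha> (Suc N - d) \<omega> * Y d \<omega>) ^ (2 * r)))"
      by (intro integrable_mult_right Bochner_Integration.integrable_sum past_norm_power_integrable[OF past_T])
    fix \<omega>
    have "cmod (x_incr n N \<omega>) \<le> (\<Sum>d\<in>S. cmod (cnj (\<alpha> (Suc N - d) \<omega>) * Y d \<omega>))"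
      unfolding x_incr_def S_def Y_def by (rule norm_sum)
    hence "cmod (x_incr n N \<omega>) ^ (2 * r) \<le> (\<Sum>d\<in>S. cmod (\<alpha> (Suc N - d) \<omega> * Y d \<omega>)) ^ (2 * r)"
      by (intro power_mono) (auto simp: norm_mult)
    also have "\<dots> \<le> real (card S) ^ (2 * r) * (\<Sum>d\<in>S. cmod (\<alpha> (Suc N - d) \<omega> * Y d \<omega>) ^ (2 * r))"
      using r by (intro sum_power_le_card_power) (auto simp: S_def)
    also have "\<dots> \<le> real n ^ (2 * r) * (\<Sum>d\<in>S. cmod (\<alpha> (Suc N - d) \<omega> * Y d \<omega>) ^ (2 * r))"
      by (intro mult_right_mono power_mono sum_nonneg) (auto simp: S_def)
    finally show "cmod (x_incr n N \<omega>) ^ (2 * r) \<le> \<dots>" .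
  qed
  also have "\<dots> = real n ^ (2 * r) * (\<Sum>d\<in>S. disc_moment \<beta> (Suc N - d) r * expectation (\<lambda>\<omega>. cmod (Y d \<omega>) ^ (2 * r)))"
    by (simp add: Bochner_Integration.integral_sum past_norm_power_integrable[OF past_T]
        expectation_norm_power_alpha_past[OF Y_past])
  also have "\<dots> \<le> real n ^ (2 * r) * (\<Sum>d\<in>S. fact r / min 1 \<beta> ^ r * real n ^ r * C / real (Suc N) ^ r)"
  proof (intro mult_left_mono sum_mono)
    fix d assume d: "d \<in> S"
    \<comment> \<open>With k = N+1-d this says k + d <= n k + n, which holds as 1 <= d <= n.\<close>
    hence "n * (Suc N - d + 1) \<ge> Suc N" 
    proof -
      have d': "1 \<le> d" "d \<le> n" "d \<le> Suc N" using d by (auto simp: S_def)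
      define k where "k = Suc N - d"
      have "Suc N = k + d" using d' by (simp add: k_def)
      also have "\<dots> \<le> n * k + n" using d' by (intro add_mono) auto
      finally show ?thesis unfolding k_def by simp
    qed
    hence "real (Suc N) \<le> real n * (real (Suc N - d) + 1)"
      by (metis of_nat_1 of_nat_add of_nat_le_iff of_nat_mult)
    hence "real (Suc N) ^ r \<le> (real n * (real (Suc N - d) + 1)) ^ r"
      by (intro power_mono) auto
    hence "real (Suc N) ^ r \<le> real n ^ r * (real (Suc N - d) + 1) ^ r"
      by (simp only: power_mult_distrib)
    hence "1 / (real (Suc N - d) + 1) ^ r \<le> real n ^ r / real (Suc N) ^ r"
      by (simp add: field_simps del: of_nat_Suc)
    hence "fact r / min 1 \<beta> ^ r * (1 / (real (Suc N - d) + 1) ^ r) \<le> fact r / min 1 \<beta> ^ r * (real n ^ r / real (Suc N) ^ r)"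
      using beta_pos by (intro mult_left_mono) auto
    with disc_moment_le[OF beta_pos, of "Suc N - d" r]
    have "disc_moment \<beta> (Suc N - d) r \<le> fact r / min 1 \<beta> ^ r * (real n ^ r / real (Suc N) ^ r)" by simp
    hence "disc_moment \<beta> (Suc N - d) r * expectation (\<lambda>\<omega>. cmod (Y d \<omega>) ^ (2 * r))
      \<le> fact r / min 1 \<beta> ^ r * (real n ^ r / real (Suc N) ^ r) * C"
      using beta_pos by (intro mult_mono Y_le[OF d]) (auto intro!: integral_nonneg_AE mult_nonneg_nonneg divide_nonneg_nonneg)
    thus "disc_moment \<beta> (Suc N - d) r * expectation (\<lambda>\<omega>. cmod (Y d \<omega>) ^ (2 * r))
      \<le> fact r / min 1 \<beta> ^ r * real n ^ r * C / real (Suc N) ^ r" by simp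
  qed auto
  also have "\<dots> \<le> real n ^ (2 * r) * (real n * (fact r / min 1 \<beta> ^ r * real n ^ r * C / real (Suc N) ^ r))"
    using beta_pos C1
    by (subst sum_constant) (intro mult_left_mono mult_right_mono, auto simp: S_def intro!: mult_nonneg_nonneg divide_nonneg_nonneg)
  finally show ?thesis by simp
qed

lemma x_part_moment_bound:
  assumes r: "r > 0"
  shows "\<exists>C\<ge>0. \<forall>m N. m \<le> N \<longrightarrow> expectation (\<lambda>\<omega>. cmod (x_part n N \<omega> - x_part n m \<omega>) ^ (2 * r)) \<le> C / real (Suc m) ^ r"
proof (induction n rule: less_induct)
  case (less n)
  then obtain c where c: "\<And>k. k < n \<Longrightarrow> c k \<ge> 0"
    "\<And>k m N. k < n \<Longrightarrow> m \<le> N \<Longrightarrow> expectation (\<lambda>\<omega>. cmod (x_part k N \<omega> - x_part k m \<omega>) ^ (2 * r)) \<le> c k / real (Suc m) ^ r"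
    by metis
  \<comment> \<open>One bound for all smaller k, and at least 1. Taking m = 0 turns the bounds on
    differences into bounds on the partial sums themselves.\<close>
  define C where "C = 1 + (\<Sum>k<n. c k)"
  have C1: "C \<ge> 1" using c(1) by (auto simp: C_def intro!: sum_nonneg)
  have C: "expectation (\<lambda>\<omega>. cmod (x_part k N \<omega>) ^ (2 * r)) \<le> C" if "k < n" for k N
  proof -
    have "expectation (\<lambda>\<omega>. cmod (x_part k N \<omega>) ^ (2 * r)) \<le> c k" using c(2)[OF that, of 0 N] by simp
    also have "c k \<le> (\<Sum>k<n. c k)" using c(1) that by (intro member_le_sum) auto
    finally show ?thesis by (simp add: C_def)
  qed
  define K where "K = real n ^ (2 * r) * (real n * (fact r / min 1 \<beta> ^ r * real n ^ r * C))"
  have K0: "K \<ge> 0" unfolding K_def using beta_pos C1 by (auto intro!: mult_nonneg_nonneg divide_nonneg_nonneg)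
  show ?case
  proof (intro exI[of _ "K * exp (2 * growth_const \<beta> r)"] conjI allI impI)
    fix m N :: nat assume "m \<le> N"
    thus "expectation (\<lambda>\<omega>. cmod (x_part n N \<omega> - x_part n m \<omega>) ^ (2 * r)) \<le> K * exp (2 * growth_const \<beta> r) / real (Suc m) ^ r"
      using r x_incr_moment_le[OF r C C1]
      by (intro moment_martingale_le[where Z = "\<lambda>N \<omega>. x_part n N \<omega> - x_part n m \<omega>" and A = "x_incr n"])
        (auto simp: x_part_Suc K_def intro!: past_diff past_x_part past_x_incr past_mono[OF past_x_part[of m n]])
  qed (use K0 in auto)
qed

end

section \<open>Convergence\<close>

text \<open>By monotone convergence the sum has finite integral, hence is finite almost everywhere.
  It takes the place of Markov plus Borel-Cantelli.\<close>

lemma AE_summable_of_summable_integral: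
  fixes f :: "nat \<Rightarrow> 'a \<Rightarrow> real"
  assumes int: "\<And>k. integrable M (f k)" and nn: "\<And>k x. 0 \<le> f k x"
    and sum: "summable (\<lambda>k. \<integral>x. f k x \<partial>M)"
  shows "AE x in M. summable (\<lambda>k. f k x)"
proof -
  have meas[measurable]: "f k \<in> borel_measurable M" for k using int by auto
  have "(\<integral>\<^sup>+x. (\<Sum>k. ennreal (f k x)) \<partial>M) = (\<Sum>k. \<integral>\<^sup>+x. ennreal (f k x) \<partial>M)"
    by (intro nn_integral_suminf) auto
  also have "\<dots> = (\<Sum>k. ennreal (\<integral>x. f k x \<partial>M))"
    using int nn by (intro suminf_cong nn_integral_eq_integral) auto
  also have "\<dots> \<noteq> \<infinity>"
    using sum nn by (simp add: ennreal_suminf_neq_top integral_nonneg_AE)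
  finally have "AE x in M. (\<Sum>k. ennreal (f k x)) \<noteq> \<infinity>"
    by (intro nn_integral_noteq_infinite) auto
  thus ?thesis
    by eventually_elim (use nn in \<open>auto intro: summable_suminf_not_top\<close>)
qed

text \<open>Fatou. The bound is asked only eventually, because the moment bounds on differences hold
  only for the larger index beyond the fixed one.\<close>

lemma nn_integral_norm_power_limit_le:
  fixes f :: "nat \<Rightarrow> 'a \<Rightarrow> complex"
  assumes [measurable]: "\<And>k. f k \<in> borel_measurable M" "g \<in> borel_measurable M"
    and lim: "AE x in M. (\<lambda>k. f k x) \<longlonglongrightarrow> g x"
    and le: "eventually (\<lambda>k. (\<integral>\<^sup>+x. ennreal (cmod (f k x) ^ r) \<partial>M) \<le> C) sequentially"
  shows "(\<integral>\<^sup>+x. ennreal (cmod (g x) ^ r) \<partial>M) \<le> C"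
proof -
  have "(\<integral>\<^sup>+x. ennreal (cmod (g x) ^ r) \<partial>M) = (\<integral>\<^sup>+x. liminf (\<lambda>k. ennreal (cmod (f k x) ^ r)) \<partial>M)"
  proof (rule nn_integral_cong_AE)
    show "AE x in M. ennreal (cmod (g x) ^ r) = liminf (\<lambda>k. ennreal (cmod (f k x) ^ r))"
      using lim
    proof eventually_elim
      case (elim x)
      hence "(\<lambda>k. ennreal (cmod (f k x) ^ r)) \<longlonglongrightarrow> ennreal (cmod (g x) ^ r)"
        by (intro tendsto_intros tendsto_ennrealI)
      from lim_imp_Liminf[OF _ this] show ?case by simp
    qed
  qed
  also have "\<dots> \<le> liminf (\<lambda>k. \<integral>\<^sup>+x. ennreal (cmod (f k x) ^ r) \<partial>M)"
    by (rule nn_integral_liminf) measurable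
  also have "\<dots> \<le> limsup (\<lambda>k. \<integral>\<^sup>+x. ennreal (cmod (f k x) ^ r) \<partial>M)"
    by (rule Liminf_le_Limsup) simp
  also have "\<dots> \<le> C" by (rule Limsup_bounded[OF le])
  finally show ?thesis .
qed

lemma integrable_of_nn_integral_norm_power:
  fixes g :: "'a \<Rightarrow> complex"
  assumes [measurable]: "g \<in> borel_measurable M" and le: "(\<integral>\<^sup>+x. ennreal (cmod (g x) ^ r) \<partial>M) \<le> ennreal C"
  shows "integrable M (\<lambda>x. cmod (g x) ^ r)" "C \<ge> 0 \<Longrightarrow> (\<integral>x. cmod (g x) ^ r \<partial>M) \<le> C"
proof -
  show 1: "integrable M (\<lambda>x. cmod (g x) ^ r)"
    by (rule integrableI_nonneg) (use le in \<open>auto intro: le_less_trans\<close>)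
  thus "(\<integral>x. cmod (g x) ^ r \<partial>M) \<le> C" if "C \<ge> 0"
    using le that by (subst (asm) nn_integral_eq_integral) auto
qed

lemma norm_diff_square_le:
  fixes a b :: complex
  shows "(cmod (a - b))\<^sup>2 \<le> 2 * (cmod a)\<^sup>2 + 2 * (cmod b)\<^sup>2"
proof -
  have "(cmod (a - b))\<^sup>2 \<le> (cmod a + cmod b)\<^sup>2"
    by (intro power_mono norm_triangle_ineq4) auto
  also have "\<dots> \<le> 2 * (cmod a)\<^sup>2 + 2 * (cmod b)\<^sup>2"
    using sum_squares_bound[of "cmod a" "cmod b"] by (simp add: power2_sum)
  finally show ?thesis .
qed

section \<open>Convergence of expectations under a uniform second moment bound\<close>

context prob_space
begin

text \<open>A uniform L2 bound gives uniform integrability: the distance truncated at K is handled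
  by dominated convergence, and what lies above K costs at most E |f_k - g|^2 / K. Fatou passes the
  L2 bound on to the limit \<open>g\<close>.\<close>

lemma integral_tendsto_of_L2_bounded:
  fixes f :: "nat \<Rightarrow> 'a \<Rightarrow> complex"
  assumes f[measurable]: "\<And>k. f k \<in> borel_measurable M" and g[measurable]: "g \<in> borel_measurable M"
    and lim: "AE x in M. (\<lambda>k. f k x) \<longlonglongrightarrow> g x"
    and le: "\<And>k. (\<integral>\<^sup>+x. ennreal ((cmod (f k x))\<^sup>2) \<partial>M) \<le> ennreal C" and C: "C \<ge> 0"
  shows "integrable M g" "(\<lambda>k. expectation (f k)) \<longlonglongrightarrow> expectation g"
proof -
  have gle: "(\<integral>\<^sup>+x. ennreal ((cmod (g x))\<^sup>2) \<partial>M) \<le> ennreal C"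
    by (rule nn_integral_norm_power_limit_le[OF f g lim]) (use le in auto)
  note fi2 = integrable_of_nn_integral_norm_power[OF f le]
  note gi2 = integrable_of_nn_integral_norm_power[OF g gle]
  have sq: "integrable M h" if "h \<in> borel_measurable M" "integrable M (\<lambda>x. (cmod (h x))\<^sup>2)" for h :: "'a \<Rightarrow> complex"
  proof (rule Bochner_Integration.integrable_bound[OF Bochner_Integration.integrable_add[OF integrable_const[of "1::real"] that(2)] that(1)])
    have "norm (h x) \<le> norm (1 + (cmod (h x))\<^sup>2)" for x
    proof -
      have "2 * cmod (h x) * 1 \<le> (cmod (h x))\<^sup>2 + 1\<^sup>2" by (rule sum_squares_bound)
      moreover have "0 \<le> cmod (h x)" by (rule norm_ge_zero)
      ultimately have "cmod (h x) \<le> 1 + (cmod (h x))\<^sup>2" unfolding power_one mult_1_right by linarith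
      also have "\<dots> \<le> norm (1 + (cmod (h x))\<^sup>2)" unfolding real_norm_def by (rule abs_ge_self)
      finally show ?thesis .
    qed
    thus "AE x in M. norm (h x) \<le> norm (1 + (cmod (h x))\<^sup>2)" by (intro AE_I2)
  qed
  have fi: "integrable M (f k)" for k by (rule sq[OF f fi2(1)])
  show gi: "integrable M g" by (rule sq[OF g gi2(1)])
  have d2: "integrable M (\<lambda>x. (cmod (f k x - g x))\<^sup>2)" "expectation (\<lambda>x. (cmod (f k x - g x))\<^sup>2) \<le> 4 * C" for k
  proof -
    have i: "integrable M (\<lambda>x. 2 * (cmod (f k x))\<^sup>2 + 2 * (cmod (g x))\<^sup>2)"
      by (intro Bochner_Integration.integrable_add integrable_mult_right fi2(1) gi2(1))
    show 1: "integrable M (\<lambda>x. (cmod (f k x - g x))\<^sup>2)"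
      by (rule Bochner_Integration.integrable_bound[OF i]) (use norm_diff_square_le in auto)
    have "expectation (\<lambda>x. (cmod (f k x - g x))\<^sup>2) \<le> expectation (\<lambda>x. 2 * (cmod (f k x))\<^sup>2 + 2 * (cmod (g x))\<^sup>2)"
      by (rule integral_mono[OF 1 i norm_diff_square_le])
    also have "\<dots> = 2 * expectation (\<lambda>x. (cmod (f k x))\<^sup>2) + 2 * expectation (\<lambda>x. (cmod (g x))\<^sup>2)"
      using fi2(1) gi2(1) by simp
    also have "\<dots> \<le> 4 * C" using fi2(2)[OF C, of k] gi2(2)[OF C] by simp
    finally show "expectation (\<lambda>x. (cmod (f k x - g x))\<^sup>2) \<le> 4 * C" .
  qed
  show "(\<lambda>k. expectation (f k)) \<longlonglongrightarrow> expectation g"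
  proof (rule LIMSEQ_I)
    fix e :: real assume e: "e > 0"
    \<comment> \<open>Chosen to push 4C/K below e/2, where 4C bounds the second moment of the
      difference. The added 1 makes the inequality strict and keeps K positive when C = 0.\<close>
    define K where "K = 8 * C / e + 1"
    have K: "K > 0" using e C by (auto simp: K_def intro: add_nonneg_pos)
    have KC: "4 * C / K < e / 2"
    proof -
      have "8 * C < e * K" using e by (simp add: K_def field_simps)
      thus ?thesis using K by (simp add: field_simps)
    qed
    have trunc_int: "integrable M (\<lambda>x. min (cmod (f k x - g x)) K)" for k
      by (rule integrable_const_bound[of _ K]) (use K in auto)
    have "(\<lambda>k. expectation (\<lambda>x. min (cmod (f k x - g x)) K)) \<longlonglongrightarrow> expectation (\<lambda>x. 0)"
    proof (rule integral_dominated_convergence[where w = "\<lambda>_. K"])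
      show "AE x in M. (\<lambda>k. min (cmod (f k x - g x)) K) \<longlonglongrightarrow> 0"
        using lim
      proof eventually_elim
        case (elim x)
        hence "(\<lambda>k. min (cmod (f k x - g x)) K) \<longlonglongrightarrow> min (cmod (g x - g x)) K"
          by (intro tendsto_intros)
        thus ?case using K by simp
      qed
      show "AE x in M. norm (min (cmod (f k x - g x)) K) \<le> K" for k using K by auto
    qed auto
    from LIMSEQ_D[OF this, of "e / 2"] e obtain k0 where
      k0: "\<And>k. k \<ge> k0 \<Longrightarrow> norm (expectation (\<lambda>x. min (cmod (f k x - g x)) K)) < e / 2" by auto
    show "\<exists>k0. \<forall>k\<ge>k0. norm (expectation (f k) - expectation g) < e"
    proof (intro exI allI impI)
      fix k assume "k \<ge> k0"
      have "norm (expectation (f k) - expectation g) = norm (expectation (\<lambda>x. f k x - g x))"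
        using fi gi by simp
      also have "\<dots> \<le> expectation (\<lambda>x. cmod (f k x - g x))" by (rule integral_norm_bound)
      also have "\<dots> \<le> expectation (\<lambda>x. min (cmod (f k x - g x)) K + (cmod (f k x - g x))\<^sup>2 / K)"
      proof (intro integral_mono)
        fix x
        show "cmod (f k x - g x) \<le> min (cmod (f k x - g x)) K + (cmod (f k x - g x))\<^sup>2 / K"
        proof (cases "cmod (f k x - g x) \<le> K")
          case False
          hence "cmod (f k x - g x) * K \<le> (cmod (f k x - g x))\<^sup>2"
            unfolding power2_eq_square by (intro mult_left_mono) auto
          hence "cmod (f k x - g x) \<le> (cmod (f k x - g x))\<^sup>2 / K" using K by (simp add: field_simps)
          thus ?thesis using False K by simp
        qed (use K in auto)
      qed (use fi gi d2(1) trunc_int in auto)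
      also have "\<dots> = expectation (\<lambda>x. min (cmod (f k x - g x)) K) + expectation (\<lambda>x. (cmod (f k x - g x))\<^sup>2) / K"
        using trunc_int d2(1) by simp
      also have "\<dots> < e / 2 + e / 2"
      proof (rule add_strict_mono)
        show "expectation (\<lambda>x. min (cmod (f k x - g x)) K) < e / 2" using k0[OF \<open>k \<ge> k0\<close>] by simp
        have "expectation (\<lambda>x. (cmod (f k x - g x))\<^sup>2) / K \<le> 4 * C / K"
          using d2(2)[of k] K by (intro divide_right_mono) auto
        with KC show "expectation (\<lambda>x. (cmod (f k x - g x))\<^sup>2) / K < e / 2" by linarith
      qed
      finally show "norm (expectation (f k) - expectation g) < e" by simp
    qed
  qed
qed

end

section \<open>Almost sure and mean square convergence of the partial sums\<close>

context disc_sequence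
begin

definition x_lim :: "nat \<Rightarrow> 'a \<Rightarrow> complex" where
  "x_lim n \<omega> = xcoeff (\<lambda>k. \<alpha> k \<omega>) n"

lemma x_lim_eq: "x_lim n \<omega> = lim (\<lambda>N. x_part n N \<omega>)"
  by (simp add: x_lim_def xcoeff_def x_part_def)

lemma x_part_measurable [measurable]: "x_part n N \<in> borel_measurable M"
  by (rule past_measurable[OF past_x_part])

lemma x_lim_measurable [measurable]: "x_lim n \<in> borel_measurable M"
  unfolding x_lim_eq[abs_def] by (rule borel_measurable_lim_metric) simp

lemma past_x_part_diff: "past (Suc (max m N)) (\<lambda>\<omega>. x_part n N \<omega> - x_part n m \<omega>)"
  by (intro past_diff past_mono[OF past_x_part]) auto

text \<open>The increments along powers of 4 have second moment O(4^(-k)). The elementary t <=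
  2^(-k) + 2^k t^2, used in place of Cauchy-Schwarz, makes their first moments O(2^(-k)), so the
  increments are almost surely absolutely summable.\<close>

lemma AE_convergent_x_part_subseq: "AE \<omega> in M. convergent (\<lambda>k. x_part n (4 ^ k) \<omega>)"
proof -
  obtain C where C: "C \<ge> 0" "\<And>m N. m \<le> N \<Longrightarrow> expectation (\<lambda>\<omega>. cmod (x_part n N \<omega> - x_part n m \<omega>) ^ 2) \<le> C / real (Suc m)"
    using x_part_moment_bound[of 1 n] by auto
  define D where "D = (\<lambda>k \<omega>. x_part n (4 ^ Suc k) \<omega> - x_part n (4 ^ k) \<omega>)"
  have pD: "past (Suc (max (4 ^ k) (4 ^ Suc k))) (D k)" for k
    unfolding D_def by (rule past_x_part_diff)
  have iD: "integrable M (\<lambda>\<omega>. cmod (D k \<omega>))" "integrable M (\<lambda>\<omega>. (cmod (D k \<omega>))\<^sup>2)" for k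
    using past_norm_power_integrable[OF pD[of k], of 1] past_norm_power_integrable[OF pD[of k], of 2] by auto
  have le: "expectation (\<lambda>\<omega>. cmod (D k \<omega>)) \<le> (1 + C) * (1 / 2) ^ k" for k
  proof -
    have "expectation (\<lambda>\<omega>. cmod (D k \<omega>)) \<le> expectation (\<lambda>\<omega>. (1 / 2) ^ k + 2 ^ k * (cmod (D k \<omega>))\<^sup>2)"
    proof (intro integral_mono)
      fix \<omega>
      have "2 * (2 ^ k * cmod (D k \<omega>)) \<le> 1 + (2 ^ k * cmod (D k \<omega>))\<^sup>2"
        using sum_squares_bound[of "2 ^ k * cmod (D k \<omega>)" 1] by (simp add: algebra_simps)
      hence "2 ^ k * cmod (D k \<omega>) \<le> 1 + (2 ^ k * cmod (D k \<omega>))\<^sup>2"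
        using mult_nonneg_nonneg[OF zero_le_power norm_ge_zero, of "2::real" k "D k \<omega>"] by linarith
      hence "(1 / 2) ^ k * (2 ^ k * cmod (D k \<omega>)) \<le> (1 / 2) ^ k * (1 + (2 ^ k * cmod (D k \<omega>))\<^sup>2)"
        by (intro mult_left_mono) auto
      thus "cmod (D k \<omega>) \<le> (1 / 2) ^ k + 2 ^ k * (cmod (D k \<omega>))\<^sup>2"
        by (simp add: power_one_over field_simps power2_eq_square)
    qed (use iD in auto)
    also have "\<dots> = (1 / 2) ^ k + 2 ^ k * expectation (\<lambda>\<omega>. (cmod (D k \<omega>))\<^sup>2)"
      using iD(2) by (simp add: prob_space)
    also have "\<dots> \<le> (1 / 2) ^ k + 2 ^ k * (C / 4 ^ k)"
    proof -
      have "expectation (\<lambda>\<omega>. (cmod (D k \<omega>))\<^sup>2) \<le> C / real (Suc (4 ^ k))"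
        unfolding D_def by (intro C(2)) auto
      also have "\<dots> \<le> C / 4 ^ k" using C(1) by (intro divide_left_mono) (auto intro!: mult_pos_pos add_pos_pos)
      finally show ?thesis by (intro add_left_mono mult_left_mono) auto
    qed
    also have "(2::real) ^ k * (C / 4 ^ k) = C * (1 / 2) ^ k"
    proof -
      have "(4::real) ^ k = (2 * 2) ^ k" by simp
      hence "(4::real) ^ k = 2 ^ k * 2 ^ k" by (simp only: power_mult_distrib)
      thus ?thesis by (simp add: power_one_over)
    qed
    finally show ?thesis by (simp only: distrib_right mult_1_left)
  qed
  have "summable (\<lambda>k. expectation (\<lambda>\<omega>. cmod (D k \<omega>)))"
  proof (rule summable_comparison_test'[where N = 0])
    show "summable (\<lambda>k. (1 + C) * (1 / 2) ^ k)" by (intro summable_mult summable_geometric) auto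
    show "norm (expectation (\<lambda>\<omega>. cmod (D k \<omega>))) \<le> (1 + C) * (1 / 2) ^ k" for k
      using le[of k] by simp
  qed
  hence "AE \<omega> in M. summable (\<lambda>k. cmod (D k \<omega>))"
    by (intro AE_summable_of_summable_integral iD) auto
  thus ?thesis
  proof eventually_elim
    case (elim \<omega>)
    have "summable (\<lambda>k. D k \<omega>)" using elim by (rule summable_norm_cancel)
    hence "convergent (\<lambda>m. \<Sum>k<m. D k \<omega>)" by (simp add: summable_iff_convergent)
    moreover have "(\<Sum>k<m. D k \<omega>) = x_part n (4 ^ m) \<omega> - x_part n 1 \<omega>" for m
      unfolding D_def by (subst sum_lessThan_telescope) simp
    ultimately have "convergent (\<lambda>m. x_part n (4 ^ m) \<omega> - x_part n 1 \<omega>)" by simp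
    thus ?case using convergent_diff_const_right_iff by blast
  qed
qed

text \<open>Fatou lets the larger index of the moment bound go to infinity along
  \<open>\<phi>\<close>. It serves twice: along powers of 4, before the full limit is known to
  exist, and along the whole sequence for the L2 statement.\<close>

lemma nn_integral_x_part_limit_le:
  assumes r: "r > 0" and L[measurable]: "L \<in> borel_measurable M" and \<phi>: "strict_mono \<phi>"
    and lim: "AE \<omega> in M. (\<lambda>k. x_part n (\<phi> k) \<omega>) \<longlonglongrightarrow> L \<omega>"
    and C: "\<And>m N. m \<le> N \<Longrightarrow> expectation (\<lambda>\<omega>. cmod (x_part n N \<omega> - x_part n m \<omega>) ^ (2 * r)) \<le> C / real (Suc m) ^ r"
  shows "(\<integral>\<^sup>+\<omega>. ennreal (cmod (x_part n m \<omega> - L \<omega>) ^ (2 * r)) \<partial>M) \<le> ennreal (C / real (Suc m) ^ r)"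
proof (rule nn_integral_norm_power_limit_le)
  show "AE \<omega> in M. (\<lambda>k. x_part n m \<omega> - x_part n (\<phi> k) \<omega>) \<longlonglongrightarrow> x_part n m \<omega> - L \<omega>"
    using lim by eventually_elim (intro tendsto_intros)
  show "\<forall>\<^sub>F k in sequentially. (\<integral>\<^sup>+\<omega>. ennreal (cmod (x_part n m \<omega> - x_part n (\<phi> k) \<omega>) ^ (2 * r)) \<partial>M) \<le> ennreal (C / real (Suc m) ^ r)"
    using eventually_ge_at_top[of m]
  proof eventually_elim
    case (elim k)
    hence "m \<le> \<phi> k" using seq_suble[OF \<phi>, of k] by simp
    from C[OF this] show ?case
      using past_norm_power_integrable[OF past_x_part_diff[of m "\<phi> k" n], of "2 * r"]
      by (subst nn_integral_eq_integral) (auto simp: norm_minus_commute simp del: of_nat_Suc intro: ennreal_leI)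
  qed
qed auto

text \<open>The limit along powers of 4 exists by second moments. The fourth moments of the distances to it
  are summable, which gives convergence of the whole sequence without a maximal inequality.\<close>

lemma AE_x_part_tendsto: "AE \<omega> in M. (\<lambda>N. x_part n N \<omega>) \<longlonglongrightarrow> x_lim n \<omega>"
proof -
  obtain C where C: "C \<ge> 0" "\<And>m N. m \<le> N \<Longrightarrow> expectation (\<lambda>\<omega>. cmod (x_part n N \<omega> - x_part n m \<omega>) ^ (2 * 2)) \<le> C / real (Suc m) ^ 2"
    using x_part_moment_bound[of 2 n] by auto
  \<comment> \<open>Only a limit along the subsequence so far; convergence of the whole sequence to
    it identifies it with \<open>x_lim\<close> at the end.\<close>
  define L where "L = (\<lambda>\<omega>. lim (\<lambda>k. x_part n (4 ^ k) \<omega>))"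
  have L[measurable]: "L \<in> borel_measurable M"
    unfolding L_def by (rule borel_measurable_lim_metric) simp
  have "AE \<omega> in M. (\<lambda>k. x_part n (4 ^ k) \<omega>) \<longlonglongrightarrow> L \<omega>"
    using AE_convergent_x_part_subseq[of n] by (simp add: L_def convergent_LIMSEQ_iff)
  hence le: "(\<integral>\<^sup>+\<omega>. ennreal (cmod (x_part n m \<omega> - L \<omega>) ^ (2 * 2)) \<partial>M) \<le> ennreal (C / real (Suc m) ^ 2)" for m
    by (intro nn_integral_x_part_limit_le[where \<phi> = "\<lambda>k. 4 ^ k"] C L) (auto intro!: strict_monoI)
  have m: "(\<lambda>\<omega>. x_part n m \<omega> - L \<omega>) \<in> borel_measurable M" for m by simp
  note i = integrable_of_nn_integral_norm_power[OF m le]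
  have "summable (\<lambda>m. expectation (\<lambda>\<omega>. cmod (x_part n m \<omega> - L \<omega>) ^ (2 * 2)))"
  proof (rule summable_comparison_test'[where N = 0])
    have "summable (\<lambda>m. inverse (real (Suc m) ^ 2))"
      using inverse_power_summable[of 2, where 'a = real] by (subst summable_Suc_iff) auto
    from summable_mult[OF this, of C] show "summable (\<lambda>m. C / real (Suc m) ^ 2)"
      by (simp add: divide_inverse)
    show "norm (expectation (\<lambda>\<omega>. cmod (x_part n m \<omega> - L \<omega>) ^ (2 * 2))) \<le> C / real (Suc m) ^ 2" for m
      using i(2)[of m] C(1) by simp
  qed
  hence "AE \<omega> in M. summable (\<lambda>m. cmod (x_part n m \<omega> - L \<omega>) ^ (2 * 2))"
    by (intro AE_summable_of_summable_integral i) auto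
  thus ?thesis
  proof eventually_elim
    case (elim \<omega>)
    hence "(\<lambda>m. cmod (x_part n m \<omega> - L \<omega>) ^ (2 * 2)) \<longlonglongrightarrow> 0" by (rule summable_LIMSEQ_zero)
    hence "(\<lambda>m. root 4 (cmod (x_part n m \<omega> - L \<omega>) ^ (2 * 2))) \<longlonglongrightarrow> root 4 0" by (intro tendsto_real_root)
    hence "(\<lambda>m. cmod (x_part n m \<omega> - L \<omega>)) \<longlonglongrightarrow> 0" by (simp add: real_root_power_cancel)
    hence *: "(\<lambda>m. x_part n m \<omega>) \<longlonglongrightarrow> L \<omega>" by (simp add: tendsto_norm_zero_iff LIM_zero_iff)
    thus ?case by (simp add: x_lim_eq limI)
  qed
qed

lemma x_part_tendsto_L2:
  "(\<lambda>N. \<integral>\<^sup>+\<omega>. ennreal ((cmod (x_part n N \<omega> - x_lim n \<omega>))\<^sup>2) \<partial>M) \<longlonglongrightarrow> 0"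
proof -
  obtain C where C: "C \<ge> 0" "\<And>m N. m \<le> N \<Longrightarrow> expectation (\<lambda>\<omega>. cmod (x_part n N \<omega> - x_part n m \<omega>) ^ (2 * 1)) \<le> C / real (Suc m) ^ 1"
    using x_part_moment_bound[of 1 n] by auto
  have "(\<integral>\<^sup>+\<omega>. ennreal (cmod (x_part n m \<omega> - x_lim n \<omega>) ^ (2 * 1)) \<partial>M) \<le> ennreal (C / real (Suc m) ^ 1)" for m
    using AE_x_part_tendsto[of n]
    by (intro nn_integral_x_part_limit_le[where \<phi> = "\<lambda>k. k"] C) (auto simp: strict_mono_def)
  hence le: "(\<integral>\<^sup>+\<omega>. ennreal ((cmod (x_part n m \<omega> - x_lim n \<omega>))\<^sup>2) \<partial>M) \<le> ennreal (C / real (Suc m))" for m by simp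
  have "(\<lambda>m. ennreal (C / real (Suc m))) \<longlonglongrightarrow> ennreal 0"
    using tendsto_mult[OF tendsto_const[of C] LIMSEQ_inverse_real_of_nat]
    by (intro tendsto_ennrealI) (simp add: divide_inverse)
  thus ?thesis
    by (intro tendsto_sandwich[OF always_eventually[OF allI[OF zero_le]] always_eventually[OF allI[OF le]] tendsto_const])
      simp
qed

end

section \<open>Moments as sums over balanced families\<close>

lemma slots_eq_Sigma: "slots p = (SIGMA n:{n. n \<noteq> 0 \<and> p n \<noteq> 0}. {1..p n})"
  by (auto simp: slots_def)

lemma multi_index_support: "multi_index p \<Longrightarrow> {n. p n \<noteq> 0} = {n. n \<noteq> 0 \<and> p n \<noteq> 0}"
  by (auto simp: multi_index_def intro: gr0I)

lemma finite_slots: assumes "multi_index p" shows "finite (slots p)"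
proof -
  have "finite {n. p n \<noteq> 0}" using assms by (simp add: multi_index_def)
  hence "finite {n. n \<noteq> 0 \<and> p n \<noteq> 0}" by (rule finite_subset[rotated]) auto
  thus ?thesis unfolding slots_eq_Sigma by (intro finite_SigmaI) auto
qed

lemma monomial_eq_prod_slots:
  assumes "multi_index p" shows "monomial p x = (\<Prod>t\<in>slots p. x (fst t))"
proof -
  have fin: "finite {n. n \<noteq> 0 \<and> p n \<noteq> 0}"
    using assms unfolding multi_index_def by (auto intro: finite_subset[rotated])
  have "monomial p x = (\<Prod>n | n \<noteq> 0 \<and> p n \<noteq> 0. \<Prod>r\<in>{1..p n}. x n)"
    unfolding monomial_def multi_index_support[OF assms] by simp
  also have "\<dots> = (\<Prod>t\<in>slots p. x (fst t))"
    unfolding slots_eq_Sigma using fin by (subst prod.Sigma) (auto simp: case_prod_unfold)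
  finally show ?thesis .
qed

lemma mdeg_eq_sum_slots:
  assumes "multi_index p" shows "mdeg p = (\<Sum>t\<in>slots p. fst t)"
proof -
  have fin: "finite {n. n \<noteq> 0 \<and> p n \<noteq> 0}"
    using assms unfolding multi_index_def by (auto intro: finite_subset[rotated])
  have "mdeg p = (\<Sum>n | n \<noteq> 0 \<and> p n \<noteq> 0. \<Sum>r\<in>{1..p n}. n)"
    unfolding mdeg_def multi_index_support[OF assms] by (simp add: mult.commute)
  also have "\<dots> = (\<Sum>t\<in>slots p. fst t)"
    unfolding slots_eq_Sigma using fin by (subst sum.Sigma) (auto simp: case_prod_unfold)
  finally show ?thesis .
qed

lemma prod_list_map_eq_prod_count_list:
  fixes a :: "nat \<Rightarrow> 'b :: comm_monoid_mult"
  assumes "set xs \<subseteq> {..N}"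
  shows "prod_list (map a xs) = (\<Prod>v\<le>N. a v ^ count_list xs v)"
  using assms
proof (induction xs)
  case (Cons x xs)
  have "(\<Prod>v\<le>N. a v ^ count_list (x # xs) v) = (\<Prod>v\<le>N. (if v = x then a v else 1) * a v ^ count_list xs v)"
    by (intro prod.cong) auto
  also have "\<dots> = a x * (\<Prod>v\<le>N. a v ^ count_list xs v)"
    using Cons.prems by (simp add: prod.distrib)
  finally show ?case using Cons by simp
qed simp

lemma prod_list_eq_prod_nth:
  fixes xs :: "'b :: comm_monoid_mult list"
  shows "prod_list xs = (\<Prod>u<length xs. xs ! u)"
  by (induction xs) (simp_all add: prod.lessThan_Suc_shift del: prod.lessThan_Suc)

lemma sum_list_eq_sum_count_list:
  assumes "set xs \<subseteq> {..N}"
  shows "sum_list xs = (\<Sum>v\<le>N. v * count_list xs v)"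
  using assms
proof (induction xs)
  case (Cons x xs)
  have "(\<Sum>v\<le>N. v * count_list (x # xs) v) = (\<Sum>v\<le>N. (if v = x then v else 0) + v * count_list xs v)"
    by (intro sum.cong) auto
  also have "\<dots> = x + (\<Sum>v\<le>N. v * count_list xs v)"
    using Cons.prems by (simp add: sum.distrib)
  finally show ?case using Cons by simp
qed simp

lemma interlaced_upto_sets:
  assumes "t \<in> interlaced_upto N n"
  shows "set (fst t) \<subseteq> {..N}" "set (snd t) \<subseteq> {..N}" "length (snd t) = length (fst t)"
    "sum_list (fst t) = sum_list (snd t) + n"
proof -
  obtain i j where t: "t = (i, j)" by (cases t)
  with assms have *: "(i, j) \<in> interlaced n" "i ! 0 \<le> N" by (auto simp: interlaced_upto_def)
  show "set (fst t) \<subseteq> {..N}" using interlaced_bounds(4)[OF *(1)] *(2) t by force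
  show "set (snd t) \<subseteq> {..N}" using interlaced_bounds(5)[OF *(1)] *(2) t by force
  show "length (snd t) = length (fst t)" "sum_list (fst t) = sum_list (snd t) + n"
    using interlaced_bounds(2,6)[OF *(1)] t by auto
qed

lemma xterm_eq_prod_count_list:
  assumes "t \<in> interlaced_upto N n"
  shows "xterm a t = (\<Prod>v\<le>N. a v ^ count_list (fst t) v * cnj (a v) ^ count_list (snd t) v)"
proof -
  note * = interlaced_upto_sets[OF assms]
  have "xterm a t = (\<Prod>u<length (fst t). a (fst t ! u)) * (\<Prod>u<length (snd t). cnj (a (snd t ! u)))"
    using *(3) by (simp add: xterm_def case_prod_unfold prod.distrib)
  also have "\<dots> = prod_list (map a (fst t)) * prod_list (map (\<lambda>v. cnj (a v)) (snd t))"
    by (simp add: prod_list_eq_prod_nth)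
  also have "\<dots> = (\<Prod>v\<le>N. a v ^ count_list (fst t) v) * (\<Prod>v\<le>N. cnj (a v) ^ count_list (snd t) v)"
    by (simp only: prod_list_map_eq_prod_count_list[OF *(1)] prod_list_map_eq_prod_count_list[OF *(2)])
  finally show ?thesis by (simp add: prod.distrib)
qed

text \<open>\<open>families p N\<close> indexes the expansion of the monomial \<open>x\<^sup>p\<close> of partial sums. In the expansion
  of \<open>x\<^sup>p (x\<^sup>q)\<^sup>*\<close>, the pair \<open>(f, g)\<close> contributes \<open>\<alpha>\<^sub>v\<close> to the power \<open>plain_exp\<close> and its conjugate
  to the power \<open>conj_exp\<close>.\<close>

definition families :: "(nat \<Rightarrow> nat) \<Rightarrow> nat \<Rightarrow> (nat \<times> nat \<Rightarrow> nat list \<times> nat list) set" where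
  "families p N = (\<Pi>\<^sub>E t\<in>slots p. interlaced_upto N (fst t))"

definition plain_exp :: "(nat \<Rightarrow> nat) \<Rightarrow> (nat \<Rightarrow> nat) \<Rightarrow>
    (nat \<times> nat \<Rightarrow> nat list \<times> nat list) \<times> (nat \<times> nat \<Rightarrow> nat list \<times> nat list) \<Rightarrow> nat \<Rightarrow> nat" where
  "plain_exp p q fg v = (\<Sum>t\<in>slots p. count_list (fst (fst fg t)) v) + (\<Sum>t\<in>slots q. count_list (snd (snd fg t)) v)"

definition conj_exp :: "(nat \<Rightarrow> nat) \<Rightarrow> (nat \<Rightarrow> nat) \<Rightarrow>
    (nat \<times> nat \<Rightarrow> nat list \<times> nat list) \<times> (nat \<times> nat \<Rightarrow> nat list \<times> nat list) \<Rightarrow> nat \<Rightarrow> nat" where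
  "conj_exp p q fg v = (\<Sum>t\<in>slots p. count_list (snd (fst fg t)) v) + (\<Sum>t\<in>slots q. count_list (fst (snd fg t)) v)"

definition balanced :: "(nat \<Rightarrow> nat) \<Rightarrow> (nat \<Rightarrow> nat) \<Rightarrow> nat \<Rightarrow>
    ((nat \<times> nat \<Rightarrow> nat list \<times> nat list) \<times> (nat \<times> nat \<Rightarrow> nat list \<times> nat list)) set" where
  "balanced p q N = {fg \<in> families p N \<times> families q N. plain_exp p q fg = conj_exp p q fg}"

lemma finite_families: "multi_index p \<Longrightarrow> finite (families p N)"
  unfolding families_def by (intro finite_PiE finite_slots) auto

lemma finite_balanced: "multi_index p \<Longrightarrow> multi_index q \<Longrightarrow> finite (balanced p q N)"
  unfolding balanced_def by (rule finite_subset[of _ "families p N \<times> families q N"]) (auto simp: finite_families)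

lemma families_mono: "N \<le> N' \<Longrightarrow> families p N \<subseteq> families p N'"
  unfolding families_def by (intro PiE_mono) (auto simp: interlaced_upto_def)

lemma balanced_mono: "N \<le> N' \<Longrightarrow> balanced p q N \<subseteq> balanced p q N'"
  using families_mono unfolding balanced_def by blast

lemma exp_outside:
  assumes "fg \<in> families p N \<times> families q N" "v > N"
  shows "plain_exp p q fg v = 0" "conj_exp p q fg v = 0"
proof -
  have *: "fst fg t \<in> interlaced_upto N (fst t)" if "t \<in> slots p" for t
    using assms that by (auto simp: families_def)
  have **: "snd fg t \<in> interlaced_upto N (fst t)" if "t \<in> slots q" for t
    using assms that by (auto simp: families_def)
  have z: "count_list xs v = 0" if "set xs \<subseteq> {..N}" for xs
    using that assms(2) by (auto simp: count_list_0_iff)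
  show "plain_exp p q fg v = 0" "conj_exp p q fg v = 0"
    unfolding plain_exp_def conj_exp_def
    using * ** by (auto intro!: z interlaced_upto_sets(1,2) sum.neutral)
qed

text \<open>In every slot the two sequences have equal length. This recovers the equality of
  exponents at index 0, where alpha_0 = 1 gives no information.\<close>

lemma sum_plain_exp_eq_sum_conj_exp:
  assumes "fg \<in> families p N \<times> families q N"
  shows "(\<Sum>v\<le>N. plain_exp p q fg v) = (\<Sum>v\<le>N. conj_exp p q fg v)"
proof -
  have *: "fst fg t \<in> interlaced_upto N (fst t)" if "t \<in> slots p" for t
    using assms that by (auto simp: families_def)
  have **: "snd fg t \<in> interlaced_upto N (fst t)" if "t \<in> slots q" for t
    using assms that by (auto simp: families_def)
  have s: "(\<Sum>v\<le>N. count_list (fst t) v) = (\<Sum>v\<le>N. count_list (snd t) v)" if "t \<in> interlaced_upto N n" for t n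
    using interlaced_upto_sets[OF that] by (simp add: sum_count_set)
  show ?thesis unfolding plain_exp_def conj_exp_def sum.distrib
    by (simp only: sum.swap[of _ _ "{..N}"] s[OF *] s[OF **] cong: sum.cong)
qed

text \<open>Weight the exponents by their index. A p-slot (n,r) contributes n more to the plain side
  than to the conjugated one, a q-slot the reverse, so equal exponents force equal degrees.\<close>

lemma balanced_mdeg_eq:
  assumes "fg \<in> balanced p q N" "multi_index p" "multi_index q"
  shows "mdeg p = mdeg q"
proof -
  have fg: "fg \<in> families p N \<times> families q N" "plain_exp p q fg = conj_exp p q fg"
    using assms(1) by (auto simp: balanced_def)
  have *: "fst fg t \<in> interlaced_upto N (fst t)" if "t \<in> slots p" for t
    using fg that by (auto simp: families_def)
  have **: "snd fg t \<in> interlaced_upto N (fst t)" if "t \<in> slots q" for t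
    using fg that by (auto simp: families_def)
  have 1: "(\<Sum>v\<le>N. v * plain_exp p q fg v) = (\<Sum>t\<in>slots p. sum_list (fst (fst fg t))) + (\<Sum>t\<in>slots q. sum_list (snd (snd fg t)))"
    unfolding plain_exp_def distrib_left sum.distrib sum_distrib_left
    by (simp add: sum.swap[of _ _ "{..N}"] sum_list_eq_sum_count_list[OF interlaced_upto_sets(1)[OF *]]
      sum_list_eq_sum_count_list[OF interlaced_upto_sets(2)[OF **]] cong: sum.cong)
  have 2: "(\<Sum>v\<le>N. v * conj_exp p q fg v) = (\<Sum>t\<in>slots p. sum_list (snd (fst fg t))) + (\<Sum>t\<in>slots q. sum_list (fst (snd fg t)))"
    unfolding conj_exp_def distrib_left sum.distrib sum_distrib_left
    by (simp add: sum.swap[of _ _ "{..N}"] sum_list_eq_sum_count_list[OF interlaced_upto_sets(2)[OF *]]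
      sum_list_eq_sum_count_list[OF interlaced_upto_sets(1)[OF **]] cong: sum.cong)
  have "(\<Sum>t\<in>slots p. sum_list (fst (fst fg t))) = (\<Sum>t\<in>slots p. sum_list (snd (fst fg t))) + mdeg p"
    by (simp add: mdeg_eq_sum_slots[OF assms(2)] interlaced_upto_sets(4)[OF *] sum.distrib cong: sum.cong)
  moreover have "(\<Sum>t\<in>slots q. sum_list (fst (snd fg t))) = (\<Sum>t\<in>slots q. sum_list (snd (snd fg t))) + mdeg q"
    by (simp add: mdeg_eq_sum_slots[OF assms(3)] interlaced_upto_sets(4)[OF **] sum.distrib cong: sum.cong)
  ultimately show ?thesis using 1 2 fg(2) by simp
qed

lemma weight_eq_prod_disc_moment:
  assumes "\<And>v. v > N \<Longrightarrow> m v = 0"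
  shows "weight \<beta> m = (\<Prod>v=1..N. disc_moment \<beta> v (m v))"
proof -
  have "weight \<beta> m = (\<Prod>v | m v \<noteq> 0. disc_moment \<beta> v (m v))"
    by (simp add: weight_def disc_moment_def)
  also have "\<dots> = (\<Prod>v\<le>N. disc_moment \<beta> v (m v))"
  proof (rule prod.mono_neutral_left)
    show "{v. m v \<noteq> 0} \<subseteq> {..N}" using assms by (auto simp: not_less[symmetric])
  qed auto
  \<comment> \<open>The factor at 0 is 1 whatever \<open>m 0\<close> is.\<close>
  also have "{..N} = insert 0 {1..N}" by auto
  finally show ?thesis by simp
qed

lemma weight_nonneg: "\<beta> > 0 \<Longrightarrow> 0 \<le> weight \<beta> m"
  by (auto simp: weight_def intro!: prod_nonneg divide_nonneg_nonneg)

text \<open>Distributing the product over slots turns it into a sum over families of terms; the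
  factors are then regrouped by the coefficient they contain. Conjugation exchanges the two
  sequences of each q-slot.\<close>

lemma monomial_product_expansion:
  assumes p: "multi_index p" and q: "multi_index q"
  shows "monomial p (\<lambda>n. xpart a N n) * cnj (monomial q (\<lambda>n. xpart a N n))
    = (\<Sum>fg\<in>families p N \<times> families q N. \<Prod>v\<le>N. a v ^ plain_exp p q fg v * cnj (a v) ^ conj_exp p q fg v)"
proof -
  have m: "monomial p (\<lambda>n. xpart a N n) = (\<Sum>f\<in>families p N. \<Prod>t\<in>slots p. xterm a (f t))" if p: "multi_index p" for p
    unfolding monomial_eq_prod_slots[OF p] xpart_eq families_def
    by (rule prod_sum_PiE) (auto intro: finite_slots p)
  have "monomial p (\<lambda>n. xpart a N n) * cnj (monomial q (\<lambda>n. xpart a N n))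
    = (\<Sum>f\<in>families p N. \<Sum>g\<in>families q N. (\<Prod>t\<in>slots p. xterm a (f t)) * (\<Prod>t\<in>slots q. cnj (xterm a (g t))))"
    unfolding m[OF p] m[OF q] cnj_sum cnj_prod sum_product ..
  also have "\<dots> = (\<Sum>fg\<in>families p N \<times> families q N. (\<Prod>t\<in>slots p. xterm a (fst fg t)) * (\<Prod>t\<in>slots q. cnj (xterm a (snd fg t))))"
    by (simp add: sum.cartesian_product case_prod_unfold)
  also have "\<dots> = (\<Sum>fg\<in>families p N \<times> families q N. \<Prod>v\<le>N. a v ^ plain_exp p q fg v * cnj (a v) ^ conj_exp p q fg v)"
  proof (rule sum.cong[OF refl])
    fix fg assume fg: "fg \<in> families p N \<times> families q N"
    have *: "fst fg t \<in> interlaced_upto N (fst t)" if "t \<in> slots p" for t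
      using fg that by (auto simp: families_def)
    have **: "snd fg t \<in> interlaced_upto N (fst t)" if "t \<in> slots q" for t
      using fg that by (auto simp: families_def)
    have 1: "(\<Prod>t\<in>slots p. xterm a (fst fg t)) = (\<Prod>v\<le>N. \<Prod>t\<in>slots p. a v ^ count_list (fst (fst fg t)) v * cnj (a v) ^ count_list (snd (fst fg t)) v)"
      by (subst prod.swap) (simp add: xterm_eq_prod_count_list[OF *] cong: prod.cong)
    have 2: "(\<Prod>t\<in>slots q. cnj (xterm a (snd fg t))) = (\<Prod>v\<le>N. \<Prod>t\<in>slots q. cnj (a v) ^ count_list (fst (snd fg t)) v * a v ^ count_list (snd (snd fg t)) v)"
      by (subst prod.swap) (simp add: xterm_eq_prod_count_list[OF **] cnj_prod cong: prod.cong)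
    show "(\<Prod>t\<in>slots p. xterm a (fst fg t)) * (\<Prod>t\<in>slots q. cnj (xterm a (snd fg t)))
       = (\<Prod>v\<le>N. a v ^ plain_exp p q fg v * cnj (a v) ^ conj_exp p q fg v)"
      unfolding 1 2 prod.distrib[symmetric]
      by (intro prod.cong refl) (simp add: prod.distrib power_sum power_add plain_exp_def conj_exp_def mult_ac)
  qed
  finally show ?thesis .
qed

text \<open>Every factor is compared with the largest, a crude substitute for the generalised
  Hoelder inequality. The 1 accounts for the empty product.\<close>

lemma prod_le_1_plus_sum_power:
  fixes a :: "'b \<Rightarrow> real"
  assumes "finite S" "\<And>t. t \<in> S \<Longrightarrow> 0 \<le> a t"
  shows "(\<Prod>t\<in>S. a t) \<le> 1 + (\<Sum>t\<in>S. a t ^ card S)"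
proof (cases "S = {}")
  case False
  obtain y where y: "y \<in> S" "\<And>x. x \<in> S \<Longrightarrow> a x \<le> a y"
    using Max_in[of "a ` S"] Max_ge[of "a ` S"] assms(1) False by fastforce
  have "(\<Prod>t\<in>S. a t) \<le> (\<Prod>t\<in>S. a y)" using y assms(2) by (intro prod_mono) auto
  also have "\<dots> = a y ^ card S" by simp
  also have "\<dots> \<le> (\<Sum>t\<in>S. a t ^ card S)"
    using y assms by (intro member_le_sum[of y S "\<lambda>x. a x ^ card S"]) auto
  finally show ?thesis by simp
qed auto

section \<open>Expectations of monomials and their limits\<close>

context disc_sequence
begin

text \<open>The top coefficient is split off by independence of the earlier ones. The exponents at 0
  stay unconstrained because alpha_0 = 1.\<close>

lemma expectation_monomial_upto:
  "expectation (\<lambda>\<omega>. \<Prod>v\<le>N. \<alpha> v \<omega> ^ a v * cnj (\<alpha> v \<omega>) ^ b v)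
    = (if \<forall>v\<in>{1..N}. a v = b v then of_real (\<Prod>v=1..N. disc_moment \<beta> v (a v)) else 0)"
proof (induction N)
  case 0
  have "expectation (\<lambda>\<omega>. \<Prod>v\<le>0. \<alpha> v \<omega> ^ a v * cnj (\<alpha> v \<omega>) ^ b v) = expectation (\<lambda>\<omega>. 1)"
    by (intro Bochner_Integration.integral_cong) (auto simp: alpha_0)
  thus ?case by (simp add: prob_space)
next
  case (Suc N)
  have "expectation (\<lambda>\<omega>. \<Prod>v\<le>Suc N. \<alpha> v \<omega> ^ a v * cnj (\<alpha> v \<omega>) ^ b v)
    = expectation (\<lambda>\<omega>. \<alpha> (Suc N) \<omega> ^ a (Suc N) * cnj (\<alpha> (Suc N) \<omega>) ^ b (Suc N) * (\<Prod>v\<le>N. \<alpha> v \<omega> ^ a v * cnj (\<alpha> v \<omega>) ^ b v))"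
    by (simp add: mult_ac)
  also have "\<dots> = (if a (Suc N) = b (Suc N) then of_real (disc_moment \<beta> (Suc N) (a (Suc N))) *
      expectation (\<lambda>\<omega>. \<Prod>v\<le>N. \<alpha> v \<omega> ^ a v * cnj (\<alpha> v \<omega>) ^ b v) else 0)"
    by (rule expectation_alpha_past) (auto intro!: past_intros)
  also have "\<dots> = (if \<forall>v\<in>{1..Suc N}. a v = b v then of_real (\<Prod>v=1..Suc N. disc_moment \<beta> v (a v)) else 0)"
    unfolding Suc.IH by (auto simp: atLeastAtMostSuc_conv mult.commute)
  finally show ?case .
qed

lemma past_monomial: "multi_index p \<Longrightarrow> past (Suc N) (\<lambda>\<omega>. monomial p (\<lambda>n. x_part n N \<omega>))"
  unfolding monomial_def by (intro past_prod past_power past_x_part)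

lemma expectation_monomial_x_part:
  assumes p: "multi_index p" and q: "multi_index q"
  shows "expectation (\<lambda>\<omega>. monomial p (\<lambda>n. x_part n N \<omega>) * cnj (monomial q (\<lambda>n. x_part n N \<omega>)))
    = of_real (\<Sum>fg\<in>balanced p q N. weight \<beta> (plain_exp p q fg))"
proof -
  have "expectation (\<lambda>\<omega>. monomial p (\<lambda>n. x_part n N \<omega>) * cnj (monomial q (\<lambda>n. x_part n N \<omega>)))
    = (\<Sum>fg\<in>families p N \<times> families q N. expectation (\<lambda>\<omega>. \<Prod>v\<le>N. \<alpha> v \<omega> ^ plain_exp p q fg v * cnj (\<alpha> v \<omega>) ^ conj_exp p q fg v))"
    unfolding x_part_def monomial_product_expansion[OF p q]
    by (intro Bochner_Integration.integral_sum past_integrable[of "Suc N"] past_intros) auto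
  also have "\<dots> = (\<Sum>fg\<in>families p N \<times> families q N. if plain_exp p q fg = conj_exp p q fg then of_real (weight \<beta> (plain_exp p q fg)) else 0)"
  proof (rule sum.cong[OF refl])
    fix fg assume fg: "fg \<in> families p N \<times> families q N"
    \<comment> \<open>Exponents above N vanish, and equality of the totals settles index 0.\<close>
    have "(\<forall>v\<in>{1..N}. plain_exp p q fg v = conj_exp p q fg v) \<longleftrightarrow> plain_exp p q fg = conj_exp p q fg"
    proof
      assume *: "\<forall>v\<in>{1..N}. plain_exp p q fg v = conj_exp p q fg v"
      have ins: "{..N} = insert 0 {1..N}" by auto
      have "(\<Sum>v=1..N. plain_exp p q fg v) = (\<Sum>v=1..N. conj_exp p q fg v)" using * by simp
      hence "plain_exp p q fg 0 = conj_exp p q fg 0"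
        using sum_plain_exp_eq_sum_conj_exp[OF fg] by (simp add: ins)
      hence "plain_exp p q fg v = conj_exp p q fg v" for v
        using * exp_outside[OF fg, of v] by (cases "v = 0"; cases "v \<le> N") auto
      thus "plain_exp p q fg = conj_exp p q fg" by auto
    qed simp
    moreover have "weight \<beta> (plain_exp p q fg) = (\<Prod>v=1..N. disc_moment \<beta> v (plain_exp p q fg v))"
      by (rule weight_eq_prod_disc_moment) (rule exp_outside[OF fg])
    ultimately show "expectation (\<lambda>\<omega>. \<Prod>v\<le>N. \<alpha> v \<omega> ^ plain_exp p q fg v * cnj (\<alpha> v \<omega>) ^ conj_exp p q fg v)
       = (if plain_exp p q fg = conj_exp p q fg then of_real (weight \<beta> (plain_exp p q fg)) else 0)"
      by (simp only: expectation_monomial_upto)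
  qed
  also have "\<dots> = (\<Sum>fg\<in>balanced p q N. of_real (weight \<beta> (plain_exp p q fg)))"
    unfolding balanced_def using p q
    by (intro sum.mono_neutral_cong_right) (auto intro: finite_families)
  finally show ?thesis by simp
qed

lemma x_part_moment_bound':
  assumes "r > 0"
  shows "\<exists>C. \<forall>N. expectation (\<lambda>\<omega>. cmod (x_part n N \<omega>) ^ (2 * r)) \<le> C"
proof -
  obtain C where "\<And>m N. m \<le> N \<Longrightarrow> expectation (\<lambda>\<omega>. cmod (x_part n N \<omega> - x_part n m \<omega>) ^ (2 * r)) \<le> C / real (Suc m) ^ r"
    using x_part_moment_bound[OF assms, of n] by auto
  from this[of 0] show ?thesis by (intro exI[of _ C]) auto
qed

text \<open>Fourth moments are what an L2 bound on a product of two monomials requires. Since x^p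
  may have many factors, this uses the moment bounds of arbitrarily high order.\<close>

lemma monomial_moment_bound:
  assumes p: "multi_index p"
  shows "\<exists>C\<ge>0. \<forall>N. expectation (\<lambda>\<omega>. cmod (monomial p (\<lambda>n. x_part n N \<omega>)) ^ 4) \<le> C"
proof (cases "slots p = {}")
  case True
  thus ?thesis by (intro exI[of _ 1]) (simp add: monomial_eq_prod_slots[OF p] prob_space)
next
  case False
  \<comment> \<open>Chosen so that the fourth power of |x|, raised to the number of slots, is the
    power \<open>2 * r\<close> covered by the moment bound.\<close>
  define r where "r = 2 * card (slots p)"
  have r: "r > 0" using False finite_slots[OF p] by (simp add: r_def card_gt_0_iff)
  obtain C where C: "\<And>n N. expectation (\<lambda>\<omega>. cmod (x_part n N \<omega>) ^ (2 * r)) \<le> C n"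
    using x_part_moment_bound'[OF r] by metis
  have C0: "C n \<ge> 0" for n
    by (rule order_trans[OF _ C[of n 0]]) (intro integral_nonneg_AE AE_I2, auto)
  note int = past_norm_power_integrable[OF past_x_part]
  have "expectation (\<lambda>\<omega>. cmod (monomial p (\<lambda>n. x_part n N \<omega>)) ^ 4) \<le> 1 + (\<Sum>t\<in>slots p. C (fst t))" for N
  proof -
    have "expectation (\<lambda>\<omega>. cmod (monomial p (\<lambda>n. x_part n N \<omega>)) ^ 4)
       \<le> expectation (\<lambda>\<omega>. 1 + (\<Sum>t\<in>slots p. cmod (x_part (fst t) N \<omega>) ^ (2 * r)))"
    proof (rule integral_mono)
      fix \<omega>
      have "(\<Prod>t\<in>slots p. cmod (x_part (fst t) N \<omega>) ^ 4) \<le> 1 + (\<Sum>t\<in>slots p. (cmod (x_part (fst t) N \<omega>) ^ 4) ^ card (slots p))"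
        by (rule prod_le_1_plus_sum_power) (auto intro: finite_slots p)
      thus "cmod (monomial p (\<lambda>n. x_part n N \<omega>)) ^ 4 \<le> 1 + (\<Sum>t\<in>slots p. cmod (x_part (fst t) N \<omega>) ^ (2 * r))"
        by (simp add: monomial_eq_prod_slots[OF p] r_def prod_norm[symmetric] prod_power_distrib flip: power_mult)
    qed (auto intro!: past_norm_power_integrable[OF past_monomial[OF p]] Bochner_Integration.integrable_add Bochner_Integration.integrable_sum int)
    also have "\<dots> = 1 + (\<Sum>t\<in>slots p. expectation (\<lambda>\<omega>. cmod (x_part (fst t) N \<omega>) ^ (2 * r)))"
      by (subst Bochner_Integration.integral_add) (auto simp: prob_space int Bochner_Integration.integral_sum intro!: Bochner_Integration.integrable_sum)
    also have "\<dots> \<le> 1 + (\<Sum>t\<in>slots p. C (fst t))" by (intro add_left_mono sum_mono C)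
    finally show ?thesis .
  qed
  thus ?thesis by (intro exI[of _ "1 + (\<Sum>t\<in>slots p. C (fst t))"]) (auto intro!: add_nonneg_nonneg sum_nonneg C0)
qed

lemma monomial_product_limit:
  assumes p: "multi_index p" and q: "multi_index q"
  shows "integrable M (\<lambda>\<omega>. monomial p (\<lambda>n. x_lim n \<omega>) * cnj (monomial q (\<lambda>n. x_lim n \<omega>)))"
    and "(\<lambda>N. complex_of_real (\<Sum>fg\<in>balanced p q N. weight \<beta> (plain_exp p q fg)))
       \<longlonglongrightarrow> expectation (\<lambda>\<omega>. monomial p (\<lambda>n. x_lim n \<omega>) * cnj (monomial q (\<lambda>n. x_lim n \<omega>)))"
proof -
  define X where "X = (\<lambda>N \<omega>. monomial p (\<lambda>n. x_part n N \<omega>) * cnj (monomial q (\<lambda>n. x_part n N \<omega>)))"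
  define Y where "Y = (\<lambda>\<omega>. monomial p (\<lambda>n. x_lim n \<omega>) * cnj (monomial q (\<lambda>n. x_lim n \<omega>)))"
  obtain C where C: "C \<ge> 0" "\<And>N. expectation (\<lambda>\<omega>. cmod (monomial p (\<lambda>n. x_part n N \<omega>)) ^ 4) \<le> C"
    using monomial_moment_bound[OF p] by auto
  obtain C' where C': "C' \<ge> 0" "\<And>N. expectation (\<lambda>\<omega>. cmod (monomial q (\<lambda>n. x_part n N \<omega>)) ^ 4) \<le> C'"
    using monomial_moment_bound[OF q] by auto
  have pX: "past (Suc N) (X N)" for N
    unfolding X_def by (intro past_mult past_cnj past_monomial p q)
  have cnj: "cnj \<in> borel_measurable borel" by (intro borel_measurable_continuous_onI continuous_intros)
  have Y: "Y \<in> borel_measurable M"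
    unfolding Y_def monomial_def
    by (intro borel_measurable_times borel_measurable_prod borel_measurable_power x_lim_measurable measurable_compose[OF _ cnj])
  have "AE \<omega> in M. \<forall>n. (\<lambda>N. x_part n N \<omega>) \<longlonglongrightarrow> x_lim n \<omega>"
    using AE_x_part_tendsto by (simp add: AE_all_countable)
  hence lim: "AE \<omega> in M. (\<lambda>N. X N \<omega>) \<longlonglongrightarrow> Y \<omega>"
    by eventually_elim (auto simp: X_def Y_def monomial_def intro!: tendsto_intros)
  have le: "(\<integral>\<^sup>+\<omega>. ennreal ((cmod (X N \<omega>))\<^sup>2) \<partial>M) \<le> ennreal (C + C')" for N
  proof -
    note i = past_norm_power_integrable[OF past_monomial[OF p], of N 4] past_norm_power_integrable[OF past_monomial[OF q], of N 4]
    have "expectation (\<lambda>\<omega>. (cmod (X N \<omega>))\<^sup>2)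
      \<le> expectation (\<lambda>\<omega>. cmod (monomial p (\<lambda>n. x_part n N \<omega>)) ^ 4 + cmod (monomial q (\<lambda>n. x_part n N \<omega>)) ^ 4)"
    proof (intro integral_mono)
      fix \<omega>
      show "(cmod (X N \<omega>))\<^sup>2 \<le> cmod (monomial p (\<lambda>n. x_part n N \<omega>)) ^ 4 + cmod (monomial q (\<lambda>n. x_part n N \<omega>)) ^ 4"
        \<comment> \<open>The case k = 1, r = 2, that is a b <= a^2 + b^2 with squared moduli for a
          and b.\<close>
        using mult_power_le_power_add[of "(cmod (monomial p (\<lambda>n. x_part n N \<omega>)))\<^sup>2" "(cmod (monomial q (\<lambda>n. x_part n N \<omega>)))\<^sup>2" 1 2]
        by (simp add: X_def norm_mult power_mult_distrib flip: power_mult)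
    qed (use past_norm_power_integrable[OF pX[of N]] i in auto)
    also have "\<dots> \<le> C + C'" using i C(2)[of N] C'(2)[of N] by simp
    finally have "expectation (\<lambda>\<omega>. (cmod (X N \<omega>))\<^sup>2) \<le> C + C'" .
    thus ?thesis using past_norm_power_integrable[OF pX[of N], of 2]
      by (subst nn_integral_eq_integral) (auto intro: ennreal_leI)
  qed
  have "0 \<le> C + C'" using C C' by simp
  note res = integral_tendsto_of_L2_bounded[OF past_measurable[OF pX] Y lim le this]
  show "integrable M (\<lambda>\<omega>. monomial p (\<lambda>n. x_lim n \<omega>) * cnj (monomial q (\<lambda>n. x_lim n \<omega>)))"
    using res(1) by (simp add: Y_def)
  show "(\<lambda>N. complex_of_real (\<Sum>fg\<in>balanced p q N. weight \<beta> (plain_exp p q fg)))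
       \<longlonglongrightarrow> expectation (\<lambda>\<omega>. monomial p (\<lambda>n. x_lim n \<omega>) * cnj (monomial q (\<lambda>n. x_lim n \<omega>)))"
    using res(2) unfolding X_def Y_def expectation_monomial_x_part[OF p q] .
qed

end

lemma has_sum_of_exhaustion:
  fixes W :: "'b \<Rightarrow> real"
  assumes nn: "\<And>x. x \<in> (\<Union>N. S N) \<Longrightarrow> 0 \<le> W x" and fin: "\<And>N. finite (S N)"
    and mono: "\<And>N N'. N \<le> N' \<Longrightarrow> S N \<subseteq> S N'" and lim: "(\<lambda>N::nat. \<Sum>x\<in>S N. W x) \<longlonglongrightarrow> s"
  shows "(W has_sum s) (\<Union>N. S N)"
proof -
  have ex: "\<exists>N. F \<subseteq> S N" if "finite F" "F \<subseteq> (\<Union>N. S N)" for F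
    using that
  proof (induction F)
    case (insert x F)
    then obtain N N' where "F \<subseteq> S N" "x \<in> S N'" by auto
    hence "insert x F \<subseteq> S (max N N')" using mono[of N "max N N'"] mono[of N' "max N N'"] by auto
    thus ?case ..
  qed auto
  have inc: "incseq (\<lambda>N. \<Sum>x\<in>S N. W x)"
    by (intro monoI sum_mono2 fin mono) (auto intro: nn)
  have "W summable_on (\<Union>N. S N)"
  proof (rule nonneg_bdd_above_summable_on)
    show "bdd_above (sum W ` {F. F \<subseteq> (\<Union>N. S N) \<and> finite F})"
    proof (rule bdd_aboveI2)
      fix F assume F: "F \<in> {F. F \<subseteq> (\<Union>N. S N) \<and> finite F}"
      then obtain N where "F \<subseteq> S N" using ex[of F] by blast
      hence "sum W F \<le> sum W (S N)" by (intro sum_mono2 fin) (auto intro: nn)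
      also have "\<dots> \<le> s" by (rule incseq_le[OF inc lim])
      finally show "sum W F \<le> s" .
    qed
  qed (rule nn)
  hence i: "(W has_sum infsum W (\<Union>N. S N)) (\<Union>N. S N)" by simp
  \<comment> \<open>The sets \<open>S N\<close> eventually contain every finite subset, so the
    unordered sum is the limit along them.\<close>
  have "filterlim S (finite_subsets_at_top (\<Union>N. S N)) sequentially"
    unfolding filterlim_finite_subsets_at_top
  proof (intro allI impI)
    fix F assume "finite F \<and> F \<subseteq> (\<Union>N. S N)"
    then obtain N where "F \<subseteq> S N" using ex[of F] by blast
    thus "\<forall>\<^sub>F y in sequentially. finite (S y) \<and> F \<subseteq> S y \<and> S y \<subseteq> (\<Union>N. S N)"
      using fin mono[of N] unfolding eventually_sequentially by (intro exI[of _ N]) blast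
  qed
  from filterlim_compose[OF i[unfolded has_sum_def] this]
  have "(\<lambda>N. \<Sum>x\<in>S N. W x) \<longlonglongrightarrow> infsum W (\<Union>N. S N)" .
  with lim have "infsum W (\<Union>N. S N) = s" by (rule LIMSEQ_unique[symmetric])
  with i show ?thesis by simp
qed

lemma weight_pos: assumes "\<beta> > 0" shows "0 < weight \<beta> m"
  unfolding weight_def using assms
  by (intro prod_pos divide_pos_pos) (auto intro!: add_nonneg_pos prod_pos)

text \<open>Only finitely many slots occur, so the sum of all first entries is a common bound for
  them.\<close>

lemma Union_balanced:
  assumes p: "multi_index p" and q: "multi_index q"
  shows "(\<Union>N. balanced p q N) = {fg \<in> (\<Pi>\<^sub>E t\<in>slots p. interlaced (fst t)) \<times> (\<Pi>\<^sub>E t\<in>slots q. interlaced (fst t)).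
     plain_exp p q fg = conj_exp p q fg}" (is "_ = ?R")
proof (intro equalityI subsetI)
  fix fg assume "fg \<in> (\<Union>N. balanced p q N)"
  then obtain N where "fst fg \<in> families p N" "snd fg \<in> families q N" "plain_exp p q fg = conj_exp p q fg"
    by (auto simp: balanced_def)
  moreover have "families p N \<subseteq> (\<Pi>\<^sub>E t\<in>slots p. interlaced (fst t))" for p
    unfolding families_def by (rule PiE_mono) (auto simp: interlaced_upto_def)
  ultimately show "fg \<in> ?R" unfolding mem_Collect_eq mem_Times_iff by blast
next
  have ex: "\<exists>N. f \<in> families p N" if f: "f \<in> (\<Pi>\<^sub>E t\<in>slots p. interlaced (fst t))" and p: "multi_index p" for f p
  proof
    have "fst (f t) ! 0 \<le> (\<Sum>t\<in>slots p. fst (f t) ! 0)" if "t \<in> slots p" for t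
      using that by (intro member_le_sum[of t _ "\<lambda>t. fst (f t) ! 0"] finite_slots p) auto
    with f show "f \<in> families p (\<Sum>t\<in>slots p. fst (f t) ! 0)"
      by (auto simp: families_def interlaced_upto_def PiE_iff case_prod_unfold)
  qed
  fix fg assume fg: "fg \<in> ?R"
  then obtain N N' where "fst fg \<in> families p N" "snd fg \<in> families q N'"
    using ex[OF _ p, of "fst fg"] ex[OF _ q, of "snd fg"] unfolding mem_Collect_eq mem_Times_iff by blast
  hence "fg \<in> balanced p q (max N N')"
    using fg families_mono[of N "max N N'" p] families_mono[of N' "max N N'" q]
    by (auto simp: balanced_def mem_Times_iff)
  thus "fg \<in> (\<Union>N. balanced p q N)" by blast
qed

text \<open>A tuple determines its m, namely as the common exponent vector, so summing over balanced
  pairs is the same as summing over m and the tuples belonging to it. Restriction to the slots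
  matches the extensionality conventions on both sides.\<close>

lemma has_sum_balanced_iff_has_sum_tuples:
  fixes W :: "(nat \<Rightarrow> nat) \<Rightarrow> real"
  assumes p: "multi_index p" and q: "multi_index q"
  shows "((\<lambda>fg. W (plain_exp p q fg)) has_sum s) (\<Union>N. balanced p q N) \<longleftrightarrow>
     ((\<lambda>(m, _). W m) has_sum s) (Sigma {m. multi_index0 m} (tuples p q))"
proof (rule has_sum_reindex_bij_witness[where
    j = "\<lambda>fg. (plain_exp p q fg, \<lambda>t\<in>slots p. fst (fst fg t), \<lambda>t\<in>slots p. snd (fst fg t),
            \<lambda>t\<in>slots q. fst (snd fg t), \<lambda>t\<in>slots q. snd (snd fg t))" and
    i = "\<lambda>(m, i, j, k, l). (\<lambda>t\<in>slots p. (i t, j t), \<lambda>t\<in>slots q. (k t, l t))"])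
  fix fg assume fg0: "fg \<in> (\<Union>N. balanced p q N)"
  hence fg: "fst fg \<in> (\<Pi>\<^sub>E t\<in>slots p. interlaced (fst t))" "snd fg \<in> (\<Pi>\<^sub>E t\<in>slots q. interlaced (fst t))"
    "plain_exp p q fg = conj_exp p q fg"
    unfolding Union_balanced[OF p q] mem_Collect_eq mem_Times_iff by blast+
  have mem: "fst fg (n, r) \<in> interlaced n" if "(n, r) \<in> slots p" for n r
    using PiE_mem[OF fg(1) that] by simp
  have mem': "snd fg (n, r) \<in> interlaced n" if "(n, r) \<in> slots q" for n r
    using PiE_mem[OF fg(2) that] by simp
  have "(\<lambda>t\<in>slots p. (fst (fst fg t), snd (fst fg t))) = fst fg" "(\<lambda>t\<in>slots q. (fst (snd fg t), snd (snd fg t))) = snd fg"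
    using fg by (auto simp: PiE_iff extensional_def fun_eq_iff)
  thus "(case (plain_exp p q fg, \<lambda>t\<in>slots p. fst (fst fg t), \<lambda>t\<in>slots p. snd (fst fg t),
            \<lambda>t\<in>slots q. fst (snd fg t), \<lambda>t\<in>slots q. snd (snd fg t)) of
         (m, i, j, k, l) \<Rightarrow> (\<lambda>t\<in>slots p. (i t, j t), \<lambda>t\<in>slots q. (k t, l t))) = fg"
    by (simp add: prod_eq_iff cong: restrict_cong)
  from fg0 obtain N where "fg \<in> families p N \<times> families q N" by (auto simp: balanced_def)
  hence "{v. plain_exp p q fg v \<noteq> 0} \<subseteq> {..N}" by (auto simp: not_less[symmetric] exp_outside(1))
  hence "multi_index0 (plain_exp p q fg)" unfolding multi_index0_def by (rule finite_subset) simp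
  moreover have "plain_exp p q fg v = (\<Sum>t\<in>slots p. count_list (snd (fst fg t)) v) + (\<Sum>t\<in>slots q. count_list (fst (snd fg t)) v)" for v
    unfolding fg(3) conj_exp_def ..
  moreover have "plain_exp p q fg v = (\<Sum>t\<in>slots p. count_list (fst (fst fg t)) v) + (\<Sum>t\<in>slots q. count_list (snd (snd fg t)) v)" for v
    unfolding plain_exp_def ..
  ultimately show "(plain_exp p q fg, \<lambda>t\<in>slots p. fst (fst fg t), \<lambda>t\<in>slots p. snd (fst fg t),
            \<lambda>t\<in>slots q. fst (snd fg t), \<lambda>t\<in>slots q. snd (snd fg t)) \<in> Sigma {m. multi_index0 m} (tuples p q)"
    using mem mem' unfolding tuples_def by auto
next
  fix b assume b: "b \<in> Sigma {m. multi_index0 m} (tuples p q)"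
  obtain m i j k l where b_eq: "b = (m, i, j, k, l)" by (cases b) auto
  have T: "i \<in> extensional (slots p)" "j \<in> extensional (slots p)" "k \<in> extensional (slots q)" "l \<in> extensional (slots q)"
    "\<And>t. t \<in> slots p \<Longrightarrow> (i t, j t) \<in> interlaced (fst t)" "\<And>t. t \<in> slots q \<Longrightarrow> (k t, l t) \<in> interlaced (fst t)"
    "\<And>N. m N = (\<Sum>t\<in>slots p. count_list (i t) N) + (\<Sum>t\<in>slots q. count_list (l t) N)"
    "\<And>N. m N = (\<Sum>t\<in>slots p. count_list (j t) N) + (\<Sum>t\<in>slots q. count_list (k t) N)"
    using b unfolding b_eq tuples_def by auto
  let ?fg = "(\<lambda>t\<in>slots p. (i t, j t), \<lambda>t\<in>slots q. (k t, l t))"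
  have 1: "plain_exp p q ?fg = m" "conj_exp p q ?fg = m"
    using T(7,8) by (auto simp: plain_exp_def conj_exp_def fun_eq_iff)
  have 2: "(\<lambda>t\<in>slots p. i t) = i" "(\<lambda>t\<in>slots p. j t) = j" "(\<lambda>t\<in>slots q. k t) = k" "(\<lambda>t\<in>slots q. l t) = l"
    using T by (auto simp: extensional_restrict)
  have 3: "?fg \<in> (\<Union>N. balanced p q N)"
    unfolding Union_balanced[OF p q] using T(5,6) 1 by auto
  have 4: "(\<lambda>t\<in>slots p. fst (fst ?fg t)) = i" "(\<lambda>t\<in>slots p. snd (fst ?fg t)) = j"
    "(\<lambda>t\<in>slots q. fst (snd ?fg t)) = k" "(\<lambda>t\<in>slots q. snd (snd ?fg t)) = l"
    using 2 by (simp_all cong: restrict_cong)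
  show "(case b of (m, i, j, k, l) \<Rightarrow> (\<lambda>t\<in>slots p. (i t, j t), \<lambda>t\<in>slots q. (k t, l t))) \<in> (\<Union>N. balanced p q N)"
    using 3 by (simp only: b_eq case_prod_conv)
  show "(\<lambda>fg. (plain_exp p q fg, \<lambda>t\<in>slots p. fst (fst fg t), \<lambda>t\<in>slots p. snd (fst fg t),
            \<lambda>t\<in>slots q. fst (snd fg t), \<lambda>t\<in>slots q. snd (snd fg t)))
      (case b of (m, i, j, k, l) \<Rightarrow> (\<lambda>t\<in>slots p. (i t, j t), \<lambda>t\<in>slots q. (k t, l t))) = b"
    by (simp only: b_eq case_prod_conv 1 4)
qed auto

text \<open>The sum is taken fibrewise over m. On a fibre the summand is constant, so the fibre
  contributes its cardinality times the weight, provided that it is finite; \<open>card\<close> of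
  an infinite set would be 0.\<close>

lemma has_sum_C_count_weight:
  assumes p: "multi_index p" and q: "multi_index q" and \<beta>: "\<beta> > 0"
    and s: "((\<lambda>fg. weight \<beta> (plain_exp p q fg)) has_sum s) (\<Union>N. balanced p q N)"
  shows "((\<lambda>m. real (C_count p q m) * weight \<beta> m) has_sum s) {m. multi_index0 m}"
proof (rule has_sum_SigmaD)
  show S: "((\<lambda>(m, _). weight \<beta> m) has_sum s) (Sigma {m. multi_index0 m} (tuples p q))"
    using s unfolding has_sum_balanced_iff_has_sum_tuples[OF p q] .
  fix m assume m: "m \<in> {m. multi_index0 m}"
  have "(\<lambda>(m, _). weight \<beta> m) summable_on (Pair m ` tuples p q m)"
    by (rule summable_on_subset_banach[OF has_sum_imp_summable[OF S]]) (use m in auto)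
  hence "(\<lambda>_. weight \<beta> m) summable_on tuples p q m"
    by (subst (asm) summable_on_reindex) (auto simp: inj_on_def o_def)
  \<comment> \<open>A nonzero constant is summable only over a finite set, and the weight is
    strictly positive.\<close>
  hence "finite (tuples p q m)"
    using infsum_diverge_constant[of "tuples p q m" "weight \<beta> m"] weight_pos[OF \<beta>, of m] by auto
  thus "((\<lambda>y. case (m, y) of (m, _) \<Rightarrow> weight \<beta> m) has_sum real (C_count p q m) * weight \<beta> m) (tuples p q m)"
    by (simp add: C_count_def)
qed

theorem theorem6p1:
  fixes M :: "'a measure" and \<alpha> :: "nat \<Rightarrow> 'a \<Rightarrow> complex" and \<beta> :: real
    and x :: "nat \<Rightarrow> 'a \<Rightarrow> complex" and p q :: "nat \<Rightarrow> nat"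
  assumes "prob_space M" and "\<beta> > 0"
    and "\<And>\<omega>. \<omega> \<in> space M \<Longrightarrow> \<alpha> 0 \<omega> = 1"
    and "\<And>n. n \<ge> 1 \<Longrightarrow> \<alpha> n \<in> borel_measurable M"
    and "distr M (Pi\<^sub>M {1..} (\<lambda>_. borel)) (\<lambda>\<omega>. \<lambda>n\<in>{1..}. \<alpha> n \<omega>) = Pi\<^sub>M {1..} (alpha_law \<beta>)"
    and "\<And>n \<omega>. x n \<omega> = xcoeff (\<lambda>k. \<alpha> k \<omega>) n"
    and "multi_index p" and "multi_index q"
  shows "(\<forall>n\<ge>1.
            (AE \<omega> in M. (\<lambda>N. xpart (\<lambda>k. \<alpha> k \<omega>) N n) \<longlonglongrightarrow> x n \<omega>) \<and>
            (\<lambda>N. \<integral>\<^sup>+\<omega>. ennreal ((cmod (xpart (\<lambda>k. \<alpha> k \<omega>) N n - x n \<omega>))\<^sup>2) \<partial>M) \<longlonglongrightarrow> 0) \<and>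
         integrable M (\<lambda>\<omega>. monomial p (\<lambda>n. x n \<omega>) * cnj (monomial q (\<lambda>n. x n \<omega>))) \<and>
         (mdeg p = mdeg q \<longrightarrow>
            ((\<lambda>m. complex_of_real (real (C_count p q m) * weight \<beta> m)) has_sum
              (\<integral>\<omega>. monomial p (\<lambda>n. x n \<omega>) * cnj (monomial q (\<lambda>n. x n \<omega>)) \<partial>M))
            {m. multi_index0 m}) \<and>
         (mdeg p \<noteq> mdeg q \<longrightarrow>
            (\<integral>\<omega>. monomial p (\<lambda>n. x n \<omega>) * cnj (monomial q (\<lambda>n. x n \<omega>)) \<partial>M) = 0)"
proof -
  interpret disc_sequence M \<alpha> \<beta>
    using assms(1-5) by (simp add: disc_sequence_def disc_sequence_axioms_def)
  note p = assms(7) and q = assms(8)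
  have x: "x n \<omega> = x_lim n \<omega>" for n \<omega> by (simp add: assms(6) x_lim_def)
  define I where "I = (\<integral>\<omega>. monomial p (\<lambda>n. x n \<omega>) * cnj (monomial q (\<lambda>n. x n \<omega>)) \<partial>M)"
  have lim: "(\<lambda>N. complex_of_real (\<Sum>fg\<in>balanced p q N. weight \<beta> (plain_exp p q fg))) \<longlonglongrightarrow> I"
    unfolding I_def x by (rule monomial_product_limit(2)[OF p q])
  \<comment> \<open>The finite sums are real, so the limit is real too, and the monotone summation
    argument for nonnegative real terms applies.\<close>
  have Re: "(\<lambda>N. \<Sum>fg\<in>balanced p q N. weight \<beta> (plain_exp p q fg)) \<longlonglongrightarrow> Re I"
    using tendsto_Re[OF lim] by simp
  have I: "I = of_real (Re I)"
    by (rule LIMSEQ_unique[OF lim tendsto_of_real[OF Re]])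
  have "((\<lambda>fg. weight \<beta> (plain_exp p q fg)) has_sum Re I) (\<Union>N. balanced p q N)"
    by (rule has_sum_of_exhaustion)
      (use Re weight_nonneg[OF beta_pos] finite_balanced[OF p q] balanced_mono in auto)
  hence "((\<lambda>m. real (C_count p q m) * weight \<beta> m) has_sum Re I) {m. multi_index0 m}"
    by (rule has_sum_C_count_weight[OF p q beta_pos])
  hence "((\<lambda>m. complex_of_real (real (C_count p q m) * weight \<beta> m)) has_sum of_real (Re I)) {m. multi_index0 m}"
    by (rule has_sum_of_real)
  with I have sum: "((\<lambda>m. complex_of_real (real (C_count p q m) * weight \<beta> m)) has_sum I) {m. multi_index0 m}"
    by (simp only:)
  have zero: "I = 0" if "mdeg p \<noteq> mdeg q"
  proof -
    have "balanced p q N = {}" for N using balanced_mdeg_eq[OF _ p q] that by blast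
    with lim show ?thesis by (simp add: LIMSEQ_const_iff)
  qed
  have "AE \<omega> in M. (\<lambda>N. xpart (\<lambda>k. \<alpha> k \<omega>) N n) \<longlonglongrightarrow> x n \<omega>" for n
    using AE_x_part_tendsto[of n] by (simp add: x_part_def x)
  moreover have "(\<lambda>N. \<integral>\<^sup>+\<omega>. ennreal ((cmod (xpart (\<lambda>k. \<alpha> k \<omega>) N n - x n \<omega>))\<^sup>2) \<partial>M) \<longlonglongrightarrow> 0" for n
    using x_part_tendsto_L2[of n] by (simp add: x_part_def x)
  moreover have "integrable M (\<lambda>\<omega>. monomial p (\<lambda>n. x n \<omega>) * cnj (monomial q (\<lambda>n. x n \<omega>)))"
    unfolding x by (rule monomial_product_limit(1)[OF p q])
  ultimately show ?thesis using sum zero unfolding I_def by blast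
qed

end
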